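(* Let $K:\mathbb{R}^n\to\mathbb{R}$ be a measurable function with $K(z)\ge 0$, $K(-z)=K(z)$ and $\int_{\mathbb{R}^n}\min(1,|z|)K(z)\,dz<\infty$. Let $\Omega\subset\mathbb{R}^n$ be a bounded open set with $\mathcal{P}(\Omega)<\infty$ and let $E\subset\mathbb{R}^n$ be measurable. Assume that $\Omega$ is foliated by sub and super solutions adapted to $E$, that is, there exists a measurable function $\phi_E:\mathbb{R}^n\to\mathbb{R}$ such that: (i) $E=\{x\in\mathbb{R}^n:\phi_E(x)>0\}$ up to a set of measure zero; (ii) the limit defining $H_K[\phi_E](x)$ exists for a.e. $x\in\Omega$, and the functions $x\mapsto \int_{\mathbb{R}^n\setminus B_\varepsilon(x)}\operatorname{sign}(\phi_E(x)-\phi_E(y))K(x-y)\,dy$ converge in $L^1(\Omega)$ to $H_K[\phi_E]$ as $\varepsilon\downarrow 0$; (iii) $H_K[\phi_E](x)\le 0$ for a.e. $x\in\Omega\cap E$, and $H_K[\phi_E](x)\ge 0$ for a.e. $x\in\Omega\setminus E$. Then: (a) $E$ is a minimizer of the $K$-nonlocal perimeter in $\Omega$. (b) Assume in addition that $K>0$ in $\mathbb{R}^n$, that $\phi_E$ is continuous, that $\{\phi_E=0\}\cap\Omega$ has zero measure, and that both $E\setminus\overline{B}_R$ and $(\overline{E})^c\setminus\overline{B}_R$ are nonempty for some ball $B_R\supset\Omega$. Then $E$ is the unique minimizer in $\Omega$ subject to its exterior datum; that is, every minimizer $F$ of the $K$-nonlocal perimeter in $\Omega$ with $F\setminus\Omega=E\setminus\Omega$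 equals $E$ up to a set of measure zero. (c) Assume in addition (to (i)–(iii)) that both inequalities in (iii) are equalities, i.e. $H_K[\phi_E]=0$ a.e. in $\Omega$. Then $\mathcal{C}_\Omega$ is a nonlocal null-Lagrangian in $\Omega$: $\mathcal{C}_\Omega(F)=\mathcal{C}_\Omega(E)$ for all measurable sets $F$ such that $F\setminus\Omega=E\setminus\Omega$ and $\mathcal{P}_\Omega(F)<\infty$.
   Context: Notation: $A^c=\mathbb{R}^n\setminus A$, $\overline{A}$ is the closure of $A$, and $\mathbf{1}_A$ is the characteristic function of $A$. For disjoint measurable sets $A,B$, $\mathcal{L}(A,B)=\int_A\int_B K(x-y)\,dy\,dx$. $\mathcal{P}(\Omega)=\mathcal{L}(\Omega,\Omega^c)$. The $K$-nonlocal perimeter of $F$ inside $\Omega$ is $\mathcal{P}_\Omega(F)=\mathcal{L}(F\cap\Omega,F^c\cap\Omega)+\mathcal{L}(F\cap\Omega,F^c\cap\Omega^c)+\mathcal{L}(F^c\cap\Omega,F\cap\Omega^c)$. A measurable set $E$ is a minimizer of the $K$-nonlocal perimeter in $\Omega$ if $\mathcal{P}_\Omega(E)\le\mathcal{P}_\Omega(F)$ for every measurable $F\subset\mathbb{R}^n$ with $F\setminus\Omega=E\setminus\Omega$. $\operatorname{sign}(t)=-1,0,1$ for $t<0$, $t=0$, $t>0$ respectively. For a measurable $\phi_E:\mathbb{R}^n\to\mathbb{R}$, $$H_K[\phi_E](x)=\lim_{\varepsilon\downarrow0}\int_{\mathbb{R}^n\setminus B_\varepsilon(x)}\operatorname{sign}(\phi_E(x)-\phi_E(y))K(x-y)\,dy$$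 whenever the limit exists. The calibration associated with $\phi_E$ is defined, for measurable $F$ with $F\setminus\Omega=E\setminus\Omega$ and $\mathcal{P}_\Omega(F)<\infty$, by $$\mathcal{C}_\Omega(F)=\int_{(\mathbb{R}^n\times\mathbb{R}^n)\setminus(\Omega^c\times\Omega^c)}\operatorname{sign}(\phi_E(x)-\phi_E(y))\,(\mathbf{1}_F(x)-\mathbf{1}_F(y))\,K(x-y)\,dx\,dy.$$
   Formalization: Part (b) is stated for n ≥ 2 only; for n = 1 it fails: with Ω = (-1,1), K(z) = |z|^(-3/2) (K(0) = 1), φ_E(x) = x, E = (0,∞), the set F = (1/2,∞) is another minimizer with the same exterior datum. *)

theory Defs
  imports "HOL-Analysis.Analysis"
begin

text \<open>
  Measurability always means Lebesgue measurability. The interaction and the perimeters of a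
  nonnegative kernel take values in \<open>[0, \<infinity>]\<close>; they are only meant for kernels \<open>K \<ge> 0\<close>, since
  \<^const>\<open>ennreal\<close> truncates negative values.
\<close>

definition interaction ::
    "(real^'n \<Rightarrow> real) \<Rightarrow> (real^'n) set \<Rightarrow> (real^'n) set \<Rightarrow> ennreal" where
  "interaction K A B = (\<integral>\<^sup>+x\<in>A. (\<integral>\<^sup>+y\<in>B. ennreal (K (x - y)) \<partial>lebesgue) \<partial>lebesgue)"

definition perimeter :: "(real^'n \<Rightarrow> real) \<Rightarrow> (real^'n) set \<Rightarrow> ennreal" where
  "perimeter K \<Omega> = interaction K \<Omega> (- \<Omega>)"

definition perimeter_in ::
    "(real^'n \<Rightarrow> real) \<Rightarrow> (real^'n) set \<Rightarrow> (real^'n) set \<Rightarrow> ennreal" where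
  "perimeter_in K \<Omega> F =
     interaction K (F \<inter> \<Omega>) (- F \<inter> \<Omega>)
   + interaction K (F \<inter> \<Omega>) (- F \<inter> - \<Omega>)
   + interaction K (- F \<inter> \<Omega>) (F \<inter> - \<Omega>)"

definition perimeter_minimizer ::
    "(real^'n \<Rightarrow> real) \<Rightarrow> (real^'n) set \<Rightarrow> (real^'n) set \<Rightarrow> bool" where
  "perimeter_minimizer K \<Omega> E \<longleftrightarrow>
     E \<in> sets lebesgue \<and>
     (\<forall>F\<in>sets lebesgue. F - \<Omega> = E - \<Omega> \<longrightarrow> perimeter_in K \<Omega> E \<le> perimeter_in K \<Omega> F)"

definition truncated_curvature ::
    "(real^'n \<Rightarrow> real) \<Rightarrow> (real^'n \<Rightarrow> real) \<Rightarrow> real \<Rightarrow> real^'n \<Rightarrow> real" where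
  "truncated_curvature K \<phi> \<epsilon> x =
     (LINT y : - ball x \<epsilon> | lebesgue. sgn (\<phi> x - \<phi> y) * K (x - y))"

text \<open>\<^const>\<open>Lim\<close> is unspecified at points where the principal value does not exist.\<close>

definition nonlocal_curvature ::
    "(real^'n \<Rightarrow> real) \<Rightarrow> (real^'n \<Rightarrow> real) \<Rightarrow> real^'n \<Rightarrow> real" where
  "nonlocal_curvature K \<phi> x = Lim (at_right 0) (\<lambda>\<epsilon>. truncated_curvature K \<phi> \<epsilon> x)"

definition converges_in_L1_on ::
    "(real^'n) set \<Rightarrow> ('i \<Rightarrow> real^'n \<Rightarrow> real) \<Rightarrow> (real^'n \<Rightarrow> real) \<Rightarrow> 'i filter \<Rightarrow> bool" where
  "converges_in_L1_on S f g \<F> \<longleftrightarrow>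
     (\<forall>\<^sub>F i in \<F>. set_integrable lebesgue S (f i)) \<and>
     set_integrable lebesgue S g \<and>
     ((\<lambda>i. LINT x : S | lebesgue. \<bar>f i x - g x\<bar>) \<longlongrightarrow> 0) \<F>"

text \<open>\<open>\<phi>\<close> foliates \<open>\<Omega>\<close> by sub and super solutions adapted to \<open>E\<close>.\<close>

definition adapted_foliation ::
    "(real^'n \<Rightarrow> real) \<Rightarrow> (real^'n) set \<Rightarrow> (real^'n) set \<Rightarrow> (real^'n \<Rightarrow> real) \<Rightarrow> bool" where
  "adapted_foliation K \<Omega> E \<phi> \<longleftrightarrow>
     \<phi> \<in> borel_measurable lebesgue \<and>
     (AE x in lebesgue. x \<in> E \<longleftrightarrow> \<phi> x > 0) \<and>
     (AE x in lebesgue. x \<in> \<Omega> \<longrightarrow>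
        (\<exists>l. ((\<lambda>\<epsilon>. truncated_curvature K \<phi> \<epsilon> x) \<longlongrightarrow> l) (at_right 0))) \<and>
     converges_in_L1_on \<Omega> (truncated_curvature K \<phi>) (nonlocal_curvature K \<phi>) (at_right 0) \<and>
     (AE x in lebesgue. x \<in> \<Omega> \<inter> E \<longrightarrow> nonlocal_curvature K \<phi> x \<le> 0) \<and>
     (AE x in lebesgue. x \<in> \<Omega> - E \<longrightarrow> nonlocal_curvature K \<phi> x \<ge> 0)"

text \<open>
  For \<open>perimeter_in K \<Omega> F < \<infinity>\<close> the integrand is absolutely integrable (its absolute value has
  integral at most \<open>2 * perimeter_in K \<Omega> F\<close>), so the default value of the Bochner integral
  plays no role there.
\<close>

definition calibration ::
    "(real^'n \<Rightarrow> real) \<Rightarrow> (real^'n) set \<Rightarrow> (real^'n \<Rightarrow> real) \<Rightarrow> (real^'n) set \<Rightarrow> real" where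
  "calibration K \<Omega> \<phi> F =
     (LINT (x, y) : UNIV - (- \<Omega>) \<times> (- \<Omega>) | lebesgue.
        sgn (\<phi> x - \<phi> y) * (indicator F x - indicator F y) * K (x - y))"

end

theory Submission imports Defs begin

text \<open>
  Everything is computed on the pairs \<open>(x, y)\<close> with \<open>x \<in> F\<close>, \<open>y \<notin> F\<close> that are not both outside
  \<open>\<Omega>\<close> (\<open>jump_pairs \<Omega> F\<close>). The perimeter of \<open>F\<close> in \<open>\<Omega>\<close> is the integral of \<open>K (x - y)\<close> over these
  pairs, and half the calibration is the integral of \<open>sgn (\<phi> x - \<phi> y) * K (x - y)\<close> over them, the
  flux of \<open>F\<close>. So the flux is at most the perimeter, with equality for \<open>E = {\<phi> > 0}\<close>.

  If \<open>K\<close> is integrable, then swapping \<open>x\<close> and \<open>y\<close> shows that the fluxes of two sets \<open>F\<close> and \<open>E\<close> with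
  the same exterior datum differ by the integral of \<open>1\<^sub>F - 1\<^sub>E\<close> against the curvature of the level
  sets of \<open>\<phi>\<close> (\<open>jump_flux_diff\<close>). For the given \<open>K\<close> this is applied to the kernel cut off near the
  origin, and the cutoff is then removed. By the \<open>L\<^sup>1\<close> convergence of the truncated curvatures
  the correction tends to the integral of \<open>(1\<^sub>F - 1\<^sub>E) * H\<close>, which is nonnegative by the sign conditions
  on \<open>H\<close>. As the perimeters with truncated kernels are finite and increase to the true ones,
  \<open>E\<close> is a minimizer (\<open>calibrated_mass_le\<close>); no finiteness of the perimeter of \<open>E\<close> has to be known in
  advance. If \<open>H\<close> vanishes the correction does too, and the calibration is a null-Lagrangian
  (\<open>flux_diff_eq_limit\<close>).

  For uniqueness, the perimeter of \<open>E\<close> is finite, because \<open>E - \<Omega>\<close> is a competitor of perimeter at most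
  that of \<open>\<Omega>\<close>. If \<open>F\<close> is another minimizer, its flux equals its perimeter, so \<open>K > 0\<close> forces
  \<open>\<phi> y < \<phi> x\<close> for almost all jump pairs of \<open>F\<close> (\<open>equal_mass_imp_ordered\<close>). If \<open>F\<close> and \<open>E\<close> differed,
  this would exclude an interval of values of \<open>\<phi>\<close>, with endpoint 0, on \<open>- \<Omega>\<close>. There are two cases. If
  \<open>\<phi>\<close> is positive somewhere outside the closed ball, then it takes all these values there by connectedness, a
  contradiction. Otherwise \<open>E\<close> and \<open>F\<close> are essentially bounded (the points of \<open>E\<close> outside the ball
  form a null set); then an extreme cap of \<open>E\<close> or \<open>F\<close> lies in \<open>\<Omega>\<close>, and cutting it off by a half-space
  strictly decreases the perimeter (\<open>halfspace_cut_decreases\<close>, \<open>minimizer_cap_contradiction\<close>).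
  The half-space comparison is itself a calibration argument: the level sets of a linear function
  have zero curvature.

  Products are taken with respect to \<^const>\<open>lborel\<close>, for which the product measure is again
  \<^const>\<open>lborel\<close>; Lebesgue measurable data are replaced by Borel representatives.
\<close>

section \<open>Reflections and products of Lebesgue measure\<close>

lemma distr_lborel_reflect:
  fixes x :: "'a::euclidean_space"
  shows "distr lborel borel (\<lambda>y. x - y) = lborel"
  by (subst lborel_affine[of "-1" x]) (auto simp: density_1 one_ennreal_def[symmetric])

lemma AE_lborel_reflect:
  fixes x :: "'a::euclidean_space"
  assumes "AE z in lborel. P z"
  shows "AE y in lborel. P (x - y)"
proof -
  have "AE z in distr lborel borel (\<lambda>y. x - y). P z"
    unfolding distr_lborel_reflect by (fact assms)
  then show ?thesis by (rule AE_distrD[rotated]) simp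
qed

lemma integrable_lborel_reflect:
  fixes x :: "'a::euclidean_space" and f :: "'a \<Rightarrow> real"
  assumes "integrable lborel f"
  shows "integrable lborel (\<lambda>y. f (x - y))"
proof -
  have "integrable (distr lborel borel (\<lambda>y. x - y)) f"
    unfolding distr_lborel_reflect by (fact assms)
  then show ?thesis by (rule integrable_distr[rotated]) simp
qed

lemma integral_lborel_reflect:
  fixes x :: "'a::euclidean_space" and f :: "'a \<Rightarrow> real"
  assumes "f \<in> borel_measurable borel"
  shows "(\<integral>y. f (x - y) \<partial>lborel) = integral\<^sup>L lborel f"
  by (subst (2) distr_lborel_reflect[of x, symmetric], subst integral_distr) (use assms in auto)

lemma AE_lborel_pair:
  fixes P :: "'a::euclidean_space \<Rightarrow> bool"
  assumes "AE z in lborel. P z"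
  shows AE_lborel_pair_fst: "AE z in lborel \<Otimes>\<^sub>M (lborel :: 'a measure). P (fst z)"
    and AE_lborel_pair_snd: "AE z in (lborel :: 'a measure) \<Otimes>\<^sub>M lborel. P (snd z)"
    and AE_lborel_pair_diff: "AE z in lborel \<Otimes>\<^sub>M lborel. P (fst z - snd z)"
proof -
  obtain N where N: "N \<in> null_sets lborel" "\<And>z. z \<notin> N \<Longrightarrow> P z"
    using AE_E3[OF assms] by auto
  have [measurable]: "N \<in> sets borel" using null_setsD2[OF N(1)] by simp
  have notN: "AE z in lborel. z \<notin> N" by (rule AE_not_in[OF N(1)])
  have "AE z in lborel \<Otimes>\<^sub>M (lborel :: 'a measure). fst z \<notin> N"
    by (rule lborel_pair.AE_pair_measure, measurable)
      (use notN in \<open>auto elim!: eventually_mono\<close>)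
  then show "AE z in lborel \<Otimes>\<^sub>M (lborel :: 'a measure). P (fst z)"
    by eventually_elim (rule N(2))
  have "AE z in (lborel :: 'a measure) \<Otimes>\<^sub>M lborel. snd z \<notin> N"
    by (rule lborel_pair.AE_pair_measure, measurable)
      (use notN in \<open>auto elim!: eventually_mono\<close>)
  then show "AE z in (lborel :: 'a measure) \<Otimes>\<^sub>M lborel. P (snd z)"
    by eventually_elim (rule N(2))
  have "AE z in lborel \<Otimes>\<^sub>M lborel. fst z - snd z \<notin> N"
    by (rule lborel_pair.AE_pair_measure, measurable) (simp add: AE_lborel_reflect[OF notN])
  then show "AE z in lborel \<Otimes>\<^sub>M lborel. P (fst z - snd z)"
    by eventually_elim (rule N(2))
qed

lemma AE_lborel_pair_swap:
  fixes P :: "'a::euclidean_space \<times> 'a \<Rightarrow> bool"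
  assumes "AE z in lborel \<Otimes>\<^sub>M lborel. P z"
  shows "AE z in lborel \<Otimes>\<^sub>M lborel. P (prod.swap z)"
proof -
  have "AE z in distr (lborel \<Otimes>\<^sub>M lborel) (lborel \<Otimes>\<^sub>M lborel) (\<lambda>(x, y). (y, x)). P z"
    unfolding lborel_pair.distr_pair_swap[symmetric] by (fact assms)
  then have "AE z in lborel \<Otimes>\<^sub>M lborel. P ((\<lambda>(x, y). (y, x)) z)"
    by (rule AE_distrD[rotated]) simp
  then show ?thesis by (simp add: split_beta' prod.swap_def)
qed

lemma nn_integral_lborel_pair_swap:
  fixes f :: "'a::euclidean_space \<times> 'a \<Rightarrow> ennreal"
  assumes [measurable]: "f \<in> borel_measurable (lborel \<Otimes>\<^sub>M lborel)"
  shows "(\<integral>\<^sup>+z. f (prod.swap z) \<partial>(lborel \<Otimes>\<^sub>M lborel)) = (\<integral>\<^sup>+z. f z \<partial>(lborel \<Otimes>\<^sub>M lborel))"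
  by (subst (2) lborel_pair.distr_pair_swap, subst nn_integral_distr)
     (auto intro!: nn_integral_cong simp: split_beta prod.swap_def)

lemma integral_lborel_pair_swap:
  fixes f :: "'a::euclidean_space \<times> 'a \<Rightarrow> real"
  assumes [measurable]: "f \<in> borel_measurable (lborel \<Otimes>\<^sub>M lborel)"
  shows "(\<integral>z. f (prod.swap z) \<partial>(lborel \<Otimes>\<^sub>M lborel)) = (\<integral>z. f z \<partial>(lborel \<Otimes>\<^sub>M lborel))"
  using lborel_pair.integral_product_swap[OF assms] by (simp add: split_beta' prod.swap_def)

lemma integrable_lborel_pair_swap:
  fixes f :: "'a::euclidean_space \<times> 'a \<Rightarrow> real"
  assumes "integrable (lborel \<Otimes>\<^sub>M lborel) f"
  shows "integrable (lborel \<Otimes>\<^sub>M lborel) (\<lambda>z. f (prod.swap z))"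
  using lborel_pair.integrable_product_swap[OF assms] by (simp add: split_beta' prod.swap_def)

section \<open>Mass and flux over the pairs separated by a set\<close>

text \<open>
  The ordered pairs that a set \<open>F\<close> separates, first component inside \<open>F\<close>, excluding those with both
  components outside \<open>\<Omega>\<close>. Each unordered separated pair is listed once.
\<close>

definition jump_pairs :: "'a set \<Rightarrow> 'a set \<Rightarrow> ('a \<times> 'a) set" where
  "jump_pairs \<Omega> F = F \<times> - F - (- \<Omega>) \<times> (- \<Omega>)"

text \<open>
  The interaction energy of a nonnegative kernel \<open>k\<close> over a set of pairs, in \<open>[0, \<infinity>]\<close>.
\<close>

definition jump_mass :: "('a::euclidean_space \<Rightarrow> real) \<Rightarrow> ('a \<times> 'a) set \<Rightarrow> ennreal" where
  "jump_mass k A = (\<integral>\<^sup>+z. ennreal (indicator A z * k (fst z - snd z)) \<partial>(lborel \<Otimes>\<^sub>M lborel))"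

text \<open>
  The energy weighted by a sign function \<open>s\<close> with values in \<open>[-1, 1]\<close>. As a Bochner integral it is only
  meaningful when the integrand is integrable, which holds as soon as \<open>jump_mass k A\<close> is finite.
\<close>

definition jump_flux ::
    "('a::euclidean_space \<Rightarrow> real) \<Rightarrow> ('a \<times> 'a \<Rightarrow> real) \<Rightarrow> ('a \<times> 'a) set \<Rightarrow> real" where
  "jump_flux k s A = (\<integral>z. indicator A z * (s z * k (fst z - snd z)) \<partial>(lborel \<Otimes>\<^sub>M lborel))"

lemma sets_jump_pairs [measurable]:
  fixes F \<Omega> :: "'a::euclidean_space set"
  assumes [measurable]: "F \<in> sets borel" "\<Omega> \<in> sets borel"
  shows "jump_pairs \<Omega> F \<in> sets (borel \<Otimes>\<^sub>M borel)"
  unfolding jump_pairs_def by measurable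

lemma integrable_strip:
  fixes k :: "'a::euclidean_space \<Rightarrow> real"
  assumes k: "integrable lborel k" and [measurable]: "\<Omega> \<in> sets borel" and "bounded \<Omega>"
  shows "integrable (lborel \<Otimes>\<^sub>M lborel) (\<lambda>z. indicator \<Omega> (fst z) * k (fst z - snd z))"
proof (rule lborel_pair.Fubini_integrable)
  have [measurable]: "k \<in> borel_measurable borel" using k by auto
  show "(\<lambda>z. indicator \<Omega> (fst z) * k (fst z - snd z)) \<in> borel_measurable (lborel \<Otimes>\<^sub>M lborel)"
    by measurable
  have "integrable lborel (indicator \<Omega> :: 'a \<Rightarrow> real)"
    using emeasure_bounded_finite[OF \<open>bounded \<Omega>\<close>] by simp
  then have "integrable lborel (\<lambda>x. indicator \<Omega> x * (\<integral>y. \<bar>k y\<bar> \<partial>lborel))" by simp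
  then show "integrable lborel (\<lambda>x. \<integral>y. norm (indicator \<Omega> (fst (x, y)) * k (fst (x, y) - snd (x, y))) \<partial>lborel)"
    by (simp add: abs_mult integral_lborel_reflect[where f="\<lambda>x. \<bar>k x\<bar>"])
  show "AE x in lborel. integrable lborel (\<lambda>y. indicator \<Omega> (fst (x, y)) * k (fst (x, y) - snd (x, y)))"
    using integrable_lborel_reflect[OF k] by simp
qed

lemma integrable_jump_flux:
  fixes k :: "'a::euclidean_space \<Rightarrow> real"
  assumes k: "integrable lborel k" and [measurable]: "F \<in> sets borel" "\<Omega> \<in> sets borel"
    and "bounded \<Omega>" and even: "\<And>z. k (- z) = k z"
    and [measurable]: "s \<in> borel_measurable (borel \<Otimes>\<^sub>M borel)" and s: "\<And>z. \<bar>s z\<bar> \<le> 1"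
  shows "integrable (lborel \<Otimes>\<^sub>M lborel)
           (\<lambda>z. indicator (jump_pairs \<Omega> F) z * (s z * k (fst z - snd z)))"
proof -
  have [measurable]: "k \<in> borel_measurable borel" using k by auto
  let ?f = "\<lambda>z. indicator \<Omega> (fst z) * k (fst z - snd z)"
  note i = integrable_strip[OF k _ \<open>bounded \<Omega>\<close>]
  have "integrable (lborel \<Otimes>\<^sub>M lborel) (\<lambda>z. \<bar>?f z\<bar> + \<bar>?f (prod.swap z)\<bar>)"
    by (intro Bochner_Integration.integrable_add integrable_abs i integrable_lborel_pair_swap) auto
  then show ?thesis
  proof (rule Bochner_Integration.integrable_bound)
    show "AE z in lborel \<Otimes>\<^sub>M lborel. norm (indicator (jump_pairs \<Omega> F) z * (s z * k (fst z - snd z)))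
       \<le> norm (\<bar>?f z\<bar> + \<bar>?f (prod.swap z)\<bar>)"
    proof (rule AE_I2, goal_cases)
      case (1 z)
      have "\<bar>s z * k (fst z - snd z)\<bar> \<le> \<bar>k (fst z - snd z)\<bar>"
        using s[of z] by (simp add: abs_mult mult_left_le_one_le)
      moreover have "k (snd z - fst z) = k (fst z - snd z)"
        using even[of "fst z - snd z"] by simp
      ultimately show ?case
        by (auto simp: indicator_def jump_pairs_def)
    qed
  qed measurable
qed

text \<open>
  The calibration identity for an integrable kernel. With \<open>g = 1\<^sub>F - 1\<^sub>E\<close>, the antisymmetry of \<open>s\<close> turns
  the difference of the two fluxes into half the integral of \<open>(g x - g y) * s (x, y) * k (x - y)\<close>, and the
  restriction to pairs not both outside \<open>\<Omega>\<close> disappears because \<open>g\<close> vanishes there.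
\<close>

lemma jump_flux_diff:
  fixes k :: "'a::euclidean_space \<Rightarrow> real"
  assumes k: "integrable lborel k"
    and F[measurable]: "F \<in> sets borel" and E[measurable]: "E \<in> sets borel"
    and \<Omega>[measurable]: "\<Omega> \<in> sets borel"
    and b: "bounded \<Omega>" and even: "\<And>z. k (- z) = k z"
    and sm[measurable]: "s \<in> borel_measurable (borel \<Otimes>\<^sub>M borel)" and s: "\<And>z. \<bar>s z\<bar> \<le> 1"
    and anti: "\<And>z. s (prod.swap z) = - s z"
    and eq: "F - \<Omega> = E - \<Omega>"
  shows "jump_flux k s (jump_pairs \<Omega> F) = jump_flux k s (jump_pairs \<Omega> E)
     + (\<integral>x. (indicator F x - indicator E x) * (\<integral>y. s (x, y) * k (x - y) \<partial>lborel) \<partial>lborel)"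
proof -
  let ?L = "lborel \<Otimes>\<^sub>M lborel :: ('a \<times> 'a) measure"
  have [measurable]: "k \<in> borel_measurable borel" using k by auto
  define u :: "'a \<times> 'a \<Rightarrow> real"
    where "u = (\<lambda>z. indicator (jump_pairs \<Omega> F) z - indicator (jump_pairs \<Omega> E) z)"
  define f where "f = (\<lambda>z. u z * (s z * k (fst z - snd z)))"
  define g where "g = (\<lambda>z. (indicator F (fst z) - indicator E (fst z)) * (s z * k (fst z - snd z)))"
  note int = integrable_jump_flux[OF k _ \<Omega> b even sm s]
  have f: "integrable ?L f" and f_eq:
    "integral\<^sup>L ?L f = jump_flux k s (jump_pairs \<Omega> F) - jump_flux k s (jump_pairs \<Omega> E)"
    unfolding f_def u_def jump_flux_def left_diff_distrib
    by (intro Bochner_Integration.integrable_diff Bochner_Integration.integral_diff int F E)+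
  have g: "integrable ?L g"
  proof (rule Bochner_Integration.integrable_bound[OF integrable_strip[OF k \<Omega> b]])
    show "g \<in> borel_measurable ?L" unfolding g_def by measurable
    show "AE z in ?L. norm (g z) \<le> norm (indicator \<Omega> (fst z) * k (fst z - snd z))"
    proof (rule AE_I2)
      fix z
      have *: "\<bar>s z * k (fst z - snd z)\<bar> \<le> \<bar>k (fst z - snd z)\<bar>"
        using s[of z] by (simp add: abs_mult mult_left_le_one_le)
      have "fst z \<notin> \<Omega> \<Longrightarrow> fst z \<in> F \<longleftrightarrow> fst z \<in> E" using eq by blast
      then show "norm (g z) \<le> norm (indicator \<Omega> (fst z) * k (fst z - snd z))"
        using * by (auto simp: g_def indicator_def)
    qed
  qed
  \<comment> \<open>Symmetrizing the two integrands makes them equal pointwise.\<close>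
  have "f z + f (prod.swap z) = g z + g (prod.swap z)" for z
  proof -
    have ev: "k (snd z - fst z) = k (fst z - snd z)"
      using even[of "fst z - snd z"] by simp
    have "u z - u (prod.swap z) = (indicator F (fst z) - indicator E (fst z))
        - (indicator F (snd z) - indicator E (snd z))"
    proof -
      have "fst z \<notin> \<Omega> \<Longrightarrow> fst z \<in> F \<longleftrightarrow> fst z \<in> E" "snd z \<notin> \<Omega> \<Longrightarrow> snd z \<in> F \<longleftrightarrow> snd z \<in> E"
        using eq by blast+
      then show ?thesis
        by (cases z) (auto simp: u_def jump_pairs_def indicator_def)
    qed
    then have "(u z - u (prod.swap z)) * (s z * k (fst z - snd z)) =
      ((indicator F (fst z) - indicator E (fst z)) - (indicator F (snd z) - indicator E (snd z)))
         * (s z * k (fst z - snd z))" by simp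
    then show ?thesis
      by (simp add: f_def g_def anti ev algebra_simps)
  qed
  then have "(\<integral>z. f z + f (prod.swap z) \<partial>?L) = (\<integral>z. g z + g (prod.swap z) \<partial>?L)" by simp
  then have "integral\<^sup>L ?L f = integral\<^sup>L ?L g"
    using f g
    by (simp add: integrable_lborel_pair_swap integral_lborel_pair_swap)
  also have "integral\<^sup>L ?L g = (\<integral>x. \<integral>y. g (x, y) \<partial>lborel \<partial>lborel)"
    by (rule lborel_pair.integral_fst'[OF g, symmetric])
  finally show ?thesis
    using f_eq by (simp add: g_def)
qed

lemma jump_mass_mono:
  "A \<subseteq> B \<Longrightarrow> (\<And>z. 0 \<le> k z) \<Longrightarrow> jump_mass k A \<le> jump_mass k B"
  unfolding jump_mass_def by (intro nn_integral_mono ennreal_leI) (auto simp: indicator_def)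

lemma jump_mass_Un:
  fixes k :: "'a::euclidean_space \<Rightarrow> real"
  assumes [measurable]: "k \<in> borel_measurable borel" "A \<in> sets (borel \<Otimes>\<^sub>M borel)" "B \<in> sets (borel \<Otimes>\<^sub>M borel)"
    and "A \<inter> B = {}"
  shows "jump_mass k (A \<union> B) = jump_mass k A + jump_mass k B"
proof -
  have "jump_mass k (A \<union> B) = (\<integral>\<^sup>+z. ennreal (indicator A z * k (fst z - snd z))
      + ennreal (indicator B z * k (fst z - snd z)) \<partial>(lborel \<Otimes>\<^sub>M lborel))"
    unfolding jump_mass_def by (intro nn_integral_cong) (use assms(4) in \<open>auto simp: indicator_def\<close>)
  also have "\<dots> = jump_mass k A + jump_mass k B"
    unfolding jump_mass_def by (rule nn_integral_add) measurable
  finally show ?thesis .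
qed

lemma jump_mass_swap:
  fixes k :: "'a::euclidean_space \<Rightarrow> real"
  assumes [measurable]: "k \<in> borel_measurable borel" "A \<in> sets borel" "B \<in> sets borel"
    and even: "\<And>z. k (- z) = k z"
  shows "jump_mass k (A \<times> B) = jump_mass k (B \<times> A)"
proof -
  have ev: "k (x - y) = k (y - x)" for x y using even[of "x - y"] by simp
  have "jump_mass k (A \<times> B) = (\<integral>\<^sup>+z. ennreal (indicator (A \<times> B) (prod.swap z) *
      k (fst (prod.swap z) - snd (prod.swap z))) \<partial>(lborel \<Otimes>\<^sub>M lborel))"
    unfolding jump_mass_def by (rule nn_integral_lborel_pair_swap[symmetric]) measurable
  also have "\<dots> = jump_mass k (B \<times> A)"
    unfolding jump_mass_def
    by (intro nn_integral_cong) (auto simp: indicator_def ev)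
  finally show ?thesis .
qed

lemma jump_mass_finite_imp_integrable:
  fixes k :: "'a::euclidean_space \<Rightarrow> real"
  assumes [measurable]: "k \<in> borel_measurable borel" "A \<in> sets (borel \<Otimes>\<^sub>M borel)"
    and k: "\<And>z. 0 \<le> k z" and fin: "jump_mass k A < \<infinity>"
    and [measurable]: "s \<in> borel_measurable (borel \<Otimes>\<^sub>M borel)" and s: "\<And>z. \<bar>s z\<bar> \<le> 1"
  shows "integrable (lborel \<Otimes>\<^sub>M lborel) (\<lambda>z. indicator A z * (s z * k (fst z - snd z)))"
proof -
  have "integrable (lborel \<Otimes>\<^sub>M lborel) (\<lambda>z. indicator A z * k (fst z - snd z))"
    by (rule integrableI_nonneg) (use fin k in \<open>auto simp: jump_mass_def\<close>)
  then show ?thesis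
  proof (rule Bochner_Integration.integrable_bound)
    show "AE z in lborel \<Otimes>\<^sub>M lborel. norm (indicator A z * (s z * k (fst z - snd z)))
       \<le> norm (indicator A z * k (fst z - snd z))"
    proof (rule AE_I2)
      fix z
      have "\<bar>s z * k (fst z - snd z)\<bar> \<le> \<bar>k (fst z - snd z)\<bar>"
        using s[of z] by (simp add: abs_mult mult_left_le_one_le)
      then show "norm (indicator A z * (s z * k (fst z - snd z)))
          \<le> norm (indicator A z * k (fst z - snd z))"
        by (auto simp: indicator_def)
    qed
  qed measurable
qed

lemma jump_mass_eq_flux:
  fixes k :: "'a::euclidean_space \<Rightarrow> real"
  assumes m [measurable]: "k \<in> borel_measurable borel" "A \<in> sets (borel \<Otimes>\<^sub>M borel)"
    and k: "\<And>z. 0 \<le> k z" and fin: "jump_mass k A < \<infinity>"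
    and [measurable]: "s \<in> borel_measurable (borel \<Otimes>\<^sub>M borel)" and s: "\<And>z. \<bar>s z\<bar> \<le> 1"
    and one: "\<And>z. z \<in> A \<Longrightarrow> s z = 1"
  shows "jump_mass k A = ennreal (jump_flux k s A)"
proof -
  have int: "integrable (lborel \<Otimes>\<^sub>M lborel) (\<lambda>z. indicator A z * (s z * k (fst z - snd z)))"
    by (rule jump_mass_finite_imp_integrable) fact+
  have "jump_mass k A = (\<integral>\<^sup>+z. ennreal (indicator A z * (s z * k (fst z - snd z))) \<partial>(lborel \<Otimes>\<^sub>M lborel))"
    unfolding jump_mass_def by (intro nn_integral_cong) (auto simp: indicator_def one)
  also have "\<dots> = ennreal (jump_flux k s A)"
    unfolding jump_flux_def
    by (rule nn_integral_eq_integral[OF int]) (auto simp: indicator_def one k)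
  finally show ?thesis .
qed

text \<open>
  The second conclusion is the equality case: a flux equal to the mass forces the sign to be 1
  wherever the kernel is positive.
\<close>

lemma jump_flux_le_mass:
  fixes k :: "'a::euclidean_space \<Rightarrow> real"
  assumes m [measurable]: "k \<in> borel_measurable borel" "A \<in> sets (borel \<Otimes>\<^sub>M borel)"
    and k: "\<And>z. 0 \<le> k z" and fin: "jump_mass k A < \<infinity>"
    and [measurable]: "s \<in> borel_measurable (borel \<Otimes>\<^sub>M borel)" and s: "\<And>z. \<bar>s z\<bar> \<le> 1"
  shows "jump_flux k s A \<le> enn2real (jump_mass k A)"
    and "jump_flux k s A = enn2real (jump_mass k A) \<Longrightarrow>
      AE z in lborel \<Otimes>\<^sub>M lborel. z \<in> A \<longrightarrow> 0 < k (fst z - snd z) \<longrightarrow> s z = 1"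
proof -
  let ?L = "lborel \<Otimes>\<^sub>M lborel :: ('a \<times> 'a) measure"
  define f where "f = (\<lambda>z. indicator A z * (s z * k (fst z - snd z)))"
  define g where "g = (\<lambda>z. indicator A z * (1 * k (fst z - snd z)))"
  have f: "integrable ?L f" unfolding f_def
    by (rule jump_mass_finite_imp_integrable) fact+
  have g: "integrable ?L g" unfolding g_def
    by (rule jump_mass_finite_imp_integrable[where s="\<lambda>_. 1"]) (use assms in auto)
  have "jump_mass k A = ennreal (jump_flux k (\<lambda>_. 1) A)"
    by (rule jump_mass_eq_flux) (use assms in auto)
  moreover have "0 \<le> jump_flux k (\<lambda>_. 1) A"
    unfolding jump_flux_def by (rule integral_nonneg_AE) (auto simp: k)
  ultimately have m: "enn2real (jump_mass k A) = integral\<^sup>L ?L g"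
    by (simp add: jump_flux_def g_def)
  have le: "f z \<le> g z" for z
  proof -
    have "s z * k (fst z - snd z) \<le> 1 * k (fst z - snd z)"
      by (rule mult_right_mono) (use s[of z] k in auto)
    then show ?thesis by (auto simp: f_def g_def indicator_def)
  qed
  have mf: "jump_flux k s A = integral\<^sup>L ?L f" by (simp add: jump_flux_def f_def)
  show "jump_flux k s A \<le> enn2real (jump_mass k A)"
    unfolding m mf by (intro integral_mono f g le)
  assume "jump_flux k s A = enn2real (jump_mass k A)"
  then have "integral\<^sup>L ?L (\<lambda>z. g z - f z) = 0"
    unfolding m mf using f g by simp
  then have "AE z in ?L. g z - f z = 0"
    by (subst (asm) integral_nonneg_eq_0_iff_AE) (use f g le in auto)
  then show "AE z in ?L. z \<in> A \<longrightarrow> 0 < k (fst z - snd z) \<longrightarrow> s z = 1"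
    by eventually_elim (auto simp: f_def g_def)
qed

section \<open>Truncation of the kernel\<close>

text \<open>
  The kernel set to zero on the open ball of radius \<open>\<epsilon>\<close> around the origin.
\<close>

definition truncate_kernel :: "('a::real_normed_vector \<Rightarrow> real) \<Rightarrow> real \<Rightarrow> 'a \<Rightarrow> real" where
  "truncate_kernel K \<epsilon> z = (if norm z < \<epsilon> then 0 else K z)"

text \<open>
  Nonnegative even Borel kernels, possibly non-integrable at the origin, with \<open>min 1 (norm z) * K z\<close>
  integrable.
\<close>

locale nonlocal_kernel =
  fixes K :: "'a::euclidean_space \<Rightarrow> real"
  assumes K_borel [measurable]: "K \<in> borel_measurable borel"
    and K_nonneg: "0 \<le> K z"
    and K_even: "K (- z) = K z"
    and K_int: "integrable lborel (\<lambda>z. min 1 (norm z) * K z)"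
begin

lemma truncate_borel [measurable]: "truncate_kernel K \<epsilon> \<in> borel_measurable borel"
  unfolding truncate_kernel_def[abs_def] by measurable

lemma truncate_nonneg: "0 \<le> truncate_kernel K \<epsilon> z"
  by (simp add: truncate_kernel_def K_nonneg)

lemma truncate_even: "truncate_kernel K \<epsilon> (- z) = truncate_kernel K \<epsilon> z"
  by (simp add: truncate_kernel_def K_even)

lemma truncate_le: "truncate_kernel K \<epsilon> z \<le> K z"
  by (simp add: truncate_kernel_def K_nonneg)

lemma truncate_integrable:
  assumes "0 < \<epsilon>"
  shows "integrable lborel (truncate_kernel K \<epsilon>)"
proof (rule Bochner_Integration.integrable_bound)
  show "integrable lborel (\<lambda>z. 1 / min 1 \<epsilon> * (min 1 (norm z) * K z))"
    using K_int by simp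
  show "AE z in lborel. norm (truncate_kernel K \<epsilon> z) \<le> norm (1 / min 1 \<epsilon> * (min 1 (norm z) * K z))"
  proof (rule AE_I2)
    fix z :: 'a
    show "norm (truncate_kernel K \<epsilon> z) \<le> norm (1 / min 1 \<epsilon> * (min 1 (norm z) * K z))"
    proof (cases "norm z < \<epsilon>")
      case False
      then have "1 * K z \<le> (min 1 (norm z) / min 1 \<epsilon>) * K z"
        using assms K_nonneg[of z] by (intro mult_right_mono) (auto simp: field_simps)
      then show ?thesis using False K_nonneg[of z] assms
        by (simp add: truncate_kernel_def abs_mult)
    qed (simp add: truncate_kernel_def)
  qed
qed measurable

lemma truncate_tendsto:
  assumes "z \<noteq> 0"
  shows "(\<lambda>n. truncate_kernel K (1 / real (Suc n)) z) \<longlonglongrightarrow> K z"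
proof (rule tendsto_eventually)
  have "(\<lambda>n. 1 / real (Suc n)) \<longlonglongrightarrow> 0" by (rule LIMSEQ_Suc[OF lim_1_over_n])
  then have "\<forall>\<^sub>F n in sequentially. 1 / real (Suc n) < norm z"
    by (rule order_tendstoD(2)) (use assms in auto)
  then show "\<forall>\<^sub>F n in sequentially. truncate_kernel K (1 / real (Suc n)) z = K z"
    by eventually_elim (simp add: truncate_kernel_def)
qed

lemma AE_off_diagonal: "AE z in lborel \<Otimes>\<^sub>M lborel. fst z - snd z \<noteq> (0::'a)"
  by (rule AE_lborel_pair_diff) (rule AE_lborel_singleton)

lemma jump_mass_truncate_le: "jump_mass (truncate_kernel K \<epsilon>) A \<le> jump_mass K A"
  unfolding jump_mass_def
  by (intro nn_integral_mono ennreal_leI) (auto simp: indicator_def truncate_le)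

lemma jump_mass_truncate_tendsto:
  assumes [measurable]: "A \<in> sets (borel \<Otimes>\<^sub>M borel)"
  shows "(\<lambda>n. jump_mass (truncate_kernel K (1 / real (Suc n))) A) \<longlonglongrightarrow> jump_mass K A"
proof -
  \<comment> \<open>On the diagonal every truncated kernel vanishes, so the pointwise limit is
    \<open>K (fst z - snd z)\<close> only off this null set.\<close>
  let ?u = "\<lambda>z. if fst z - snd z = (0::'a) then ennreal (indicator A z * truncate_kernel K 1 (fst z - snd z))
    else ennreal (indicator A z * K (fst z - snd z))"
  have "(\<lambda>n. jump_mass (truncate_kernel K (1 / real (Suc n))) A)
      \<longlonglongrightarrow> (\<integral>\<^sup>+z. ?u z \<partial>(lborel \<Otimes>\<^sub>M lborel))"
    unfolding jump_mass_def
  proof (rule nn_integral_LIMSEQ)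
    show "incseq (\<lambda>n z. ennreal (indicator A z * truncate_kernel K (1 / real (Suc n)) (fst z - snd z)))"
    proof (intro incseq_SucI le_funI ennreal_leI mult_left_mono)
      fix n and z :: "'a \<times> 'a"
      have "1 / real (Suc (Suc n)) \<le> 1 / real (Suc n)" by (intro divide_left_mono) auto
      then show "truncate_kernel K (1 / real (Suc n)) (fst z - snd z)
        \<le> truncate_kernel K (1 / real (Suc (Suc n))) (fst z - snd z)"
        by (auto simp: truncate_kernel_def K_nonneg simp del: of_nat_Suc)
    qed simp
    show "(\<lambda>n. ennreal (indicator A z * truncate_kernel K (1 / real (Suc n)) (fst z - snd z)))
       \<longlonglongrightarrow> ?u z" for z
    proof (cases "fst z - snd z = 0")
      case True
      then show ?thesis by (simp add: truncate_kernel_def)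
    next
      case False
      then show ?thesis
        by (simp only: if_False) (intro tendsto_ennrealI tendsto_mult tendsto_const truncate_tendsto)
    qed
  qed measurable
  also have "(\<integral>\<^sup>+z. ?u z \<partial>(lborel \<Otimes>\<^sub>M lborel)) = jump_mass K A"
    unfolding jump_mass_def
    by (rule nn_integral_cong_AE) (use AE_off_diagonal in eventually_elim, simp)
  finally show ?thesis .
qed

lemma jump_flux_truncate_tendsto:
  assumes [measurable]: "A \<in> sets (borel \<Otimes>\<^sub>M borel)" and fin: "jump_mass K A < \<infinity>"
    and [measurable]: "s \<in> borel_measurable (borel \<Otimes>\<^sub>M borel)" and s: "\<And>z. \<bar>s z\<bar> \<le> 1"
  shows "(\<lambda>n. jump_flux (truncate_kernel K (1 / real (Suc n))) s A) \<longlonglongrightarrow> jump_flux K s A"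
  unfolding jump_flux_def
proof (rule integral_dominated_convergence)
  show "integrable (lborel \<Otimes>\<^sub>M lborel) (\<lambda>z. indicator A z * (1 * K (fst z - snd z)))"
    by (rule jump_mass_finite_imp_integrable[where s="\<lambda>_. 1"]) (use fin in \<open>auto simp: K_nonneg\<close>)
  show "AE z in lborel \<Otimes>\<^sub>M lborel. (\<lambda>n. indicator A z * (s z * truncate_kernel K (1 / real (Suc n)) (fst z - snd z)))
      \<longlonglongrightarrow> indicator A z * (s z * K (fst z - snd z))"
    using AE_off_diagonal by eventually_elim (intro tendsto_mult tendsto_const truncate_tendsto)
  show "AE z in lborel \<Otimes>\<^sub>M lborel. norm (indicator A z * (s z * truncate_kernel K (1 / real (Suc n)) (fst z - snd z)))
      \<le> indicator A z * (1 * K (fst z - snd z))" for n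
  proof (rule AE_I2)
    fix z
    have "\<bar>s z\<bar> * truncate_kernel K (1 / real (Suc n)) (fst z - snd z) \<le> 1 * K (fst z - snd z)"
      by (intro mult_mono s truncate_le truncate_nonneg) auto
    then show "norm (indicator A z * (s z * truncate_kernel K (1 / real (Suc n)) (fst z - snd z)))
      \<le> indicator A z * (1 * K (fst z - snd z))"
      by (auto simp: indicator_def abs_mult truncate_nonneg)
  qed
qed measurable

lemma jump_mass_truncate_finite:
  assumes "0 < \<epsilon>" and [measurable]: "F \<in> sets borel" "\<Omega> \<in> sets borel" and "bounded \<Omega>"
  shows "jump_mass (truncate_kernel K \<epsilon>) (jump_pairs \<Omega> F) < \<infinity>"
proof -
  have "integrable (lborel \<Otimes>\<^sub>M lborel)
      (\<lambda>z. indicator (jump_pairs \<Omega> F) z * (1 * truncate_kernel K \<epsilon> (fst z - snd z)))"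
    by (rule integrable_jump_flux[where s="\<lambda>_. 1"])
       (use assms in \<open>auto simp: truncate_even intro: truncate_integrable\<close>)
  then show ?thesis
    unfolding jump_mass_def
    by (subst nn_integral_eq_integral) (auto simp: truncate_nonneg)
qed

end

section \<open>Level sets of a function as calibration\<close>

text \<open>
  The sign that orders a pair of points by the values of \<open>\<phi>\<close>.
\<close>

definition level_sign :: "('a \<Rightarrow> real) \<Rightarrow> 'a \<times> 'a \<Rightarrow> real" where
  "level_sign \<phi> z = sgn (\<phi> (fst z) - \<phi> (snd z))"

lemma level_sign_borel [measurable]:
  fixes \<phi> :: "'a::euclidean_space \<Rightarrow> real"
  assumes [measurable]: "\<phi> \<in> borel_measurable borel"
  shows "level_sign \<phi> \<in> borel_measurable (borel \<Otimes>\<^sub>M borel)"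
  unfolding level_sign_def[abs_def] by measurable

lemma level_sign_bound: "\<bar>level_sign \<phi> z\<bar> \<le> 1"
  by (simp add: level_sign_def abs_sgn_eq)

lemma level_sign_swap: "level_sign \<phi> (prod.swap z) = - level_sign \<phi> z"
  by (simp add: level_sign_def sgn_if)

text \<open>
  The integral of \<open>1\<^sub>F - 1\<^sub>E\<close> against the \<open>k\<close>-curvature of the level sets of \<open>\<phi>\<close>, for integrable \<open>k\<close>.
\<close>

definition curvature_pairing ::
    "('a::euclidean_space \<Rightarrow> real) \<Rightarrow> ('a \<Rightarrow> real) \<Rightarrow> 'a set \<Rightarrow> 'a set \<Rightarrow> real" where
  "curvature_pairing k \<phi> F E =
     (\<integral>x. (indicator F x - indicator E x) * (\<integral>y. sgn (\<phi> x - \<phi> y) * k (x - y) \<partial>lborel) \<partial>lborel)"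

context nonlocal_kernel
begin

lemma truncated_flux_diff:
  assumes [measurable]: "F \<in> sets borel" "E \<in> sets borel" "\<Omega> \<in> sets borel" "\<phi> \<in> borel_measurable borel"
    and "bounded \<Omega>" and "F - \<Omega> = E - \<Omega>" and "0 < \<epsilon>"
  shows "jump_flux (truncate_kernel K \<epsilon>) (level_sign \<phi>) (jump_pairs \<Omega> F)
     = jump_flux (truncate_kernel K \<epsilon>) (level_sign \<phi>) (jump_pairs \<Omega> E)
     + curvature_pairing (truncate_kernel K \<epsilon>) \<phi> F E"
  using jump_flux_diff[OF truncate_integrable[OF \<open>0 < \<epsilon>\<close>] assms(1,2,3,5) truncate_even
      level_sign_borel[OF assms(4)] level_sign_bound level_sign_swap assms(6)]
  by (simp add: curvature_pairing_def level_sign_def[where z="(x, y)" for x y])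

text \<open>
  Hyperplanes have zero curvature, since the integrand is odd about \<open>x\<close>.
\<close>

lemma linear_level_curvature_zero:
  "(\<integral>y. sgn (e \<bullet> x - e \<bullet> y) * truncate_kernel K \<epsilon> (x - y) \<partial>lborel) = 0"
proof -
  let ?f = "\<lambda>z. sgn (e \<bullet> z) * truncate_kernel K \<epsilon> z"
  have f: "?f \<in> borel_measurable borel" by measurable
  have "(\<integral>y. ?f (0 - y) \<partial>lborel) = integral\<^sup>L lborel ?f"
    by (rule integral_lborel_reflect[OF f])
  then have "integral\<^sup>L lborel ?f = 0"
    by (simp add: truncate_even sgn_minus)
  then show ?thesis
    using integral_lborel_reflect[OF f, of x] by (simp add: inner_diff_right)
qed

text \<open>
  A bounded set \<open>D\<close> inside a closed half-space interacts with the complementary half-space at most as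
  much as with the rest of its own half-space. For truncated kernels this follows from the
  vanishing flux of \<open>D\<close> with respect to the linear function \<open>x \<mapsto> e \<bullet> x\<close>.
\<close>

lemma halfspace_interaction_le:
  assumes [measurable]: "D \<in> sets borel" and "bounded D" and D: "\<And>x. x \<in> D \<Longrightarrow> c \<le> e \<bullet> x"
  shows "jump_mass K (D \<times> {y. e \<bullet> y < c}) \<le> jump_mass K (D \<times> ({y. c \<le> e \<bullet> y} - D))"
proof (rule LIMSEQ_le)
  let ?A = "D \<times> {y. e \<bullet> y < c}" and ?B = "D \<times> ({y. c \<le> e \<bullet> y} - D)"
  have [measurable]: "?A \<in> sets (borel \<Otimes>\<^sub>M borel)" "?B \<in> sets (borel \<Otimes>\<^sub>M borel)" by measurable
  show "(\<lambda>n. jump_mass (truncate_kernel K (1 / real (Suc n))) ?A) \<longlonglongrightarrow> jump_mass K ?A"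
    and "(\<lambda>n. jump_mass (truncate_kernel K (1 / real (Suc n))) ?B) \<longlonglongrightarrow> jump_mass K ?B"
    by (rule jump_mass_truncate_tendsto, measurable)+
  have "jump_mass (truncate_kernel K \<epsilon>) ?A \<le> jump_mass (truncate_kernel K \<epsilon>) ?B" if \<epsilon>: "0 < \<epsilon>" for \<epsilon>
  proof -
    let ?k = "truncate_kernel K \<epsilon>" and ?s = "level_sign (\<lambda>x. e \<bullet> x)"
    have sm [measurable]: "?s \<in> borel_measurable (borel \<Otimes>\<^sub>M borel)" by measurable
    have split: "jump_pairs D D = ?A \<union> ?B" using D by (fastforce simp: jump_pairs_def)
    have "jump_mass ?k (jump_pairs D D) < \<infinity>"
      by (rule jump_mass_truncate_finite) (use assms \<epsilon> in auto)
    then have fin: "jump_mass ?k ?A < \<infinity>" "jump_mass ?k ?B < \<infinity>"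
      using jump_mass_mono[of ?A "jump_pairs D D" ?k] jump_mass_mono[of ?B "jump_pairs D D" ?k]
      by (auto simp: split truncate_nonneg)
    have intA: "integrable (lborel \<Otimes>\<^sub>M lborel) (\<lambda>z. indicator ?A z * (?s z * ?k (fst z - snd z)))"
      by (rule jump_mass_finite_imp_integrable)
         (use fin in \<open>auto simp: truncate_nonneg level_sign_bound\<close>)
    have intB: "integrable (lborel \<Otimes>\<^sub>M lborel) (\<lambda>z. indicator ?B z * (?s z * ?k (fst z - snd z)))"
      by (rule jump_mass_finite_imp_integrable)
         (use fin in \<open>auto simp: truncate_nonneg level_sign_bound\<close>)
    have "jump_flux ?k ?s (jump_pairs D D) = jump_flux ?k ?s (jump_pairs D {}) + 0"
      using truncated_flux_diff[of D "{}" D "\<lambda>x. e \<bullet> x" \<epsilon>] \<epsilon> \<open>bounded D\<close>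
      by (simp add: curvature_pairing_def linear_level_curvature_zero)
    then have "jump_flux ?k ?s (jump_pairs D D) = 0"
      by (simp add: jump_flux_def jump_pairs_def)
    moreover have "jump_flux ?k ?s (jump_pairs D D) = jump_flux ?k ?s ?A + jump_flux ?k ?s ?B"
    proof -
      have "jump_flux ?k ?s (jump_pairs D D) =
        (\<integral>z. indicator ?A z * (?s z * ?k (fst z - snd z)) + indicator ?B z * (?s z * ?k (fst z - snd z)) \<partial>(lborel \<Otimes>\<^sub>M lborel))"
        unfolding split jump_flux_def
        by (intro Bochner_Integration.integral_cong) (auto simp: indicator_def)
      also have "\<dots> = jump_flux ?k ?s ?A + jump_flux ?k ?s ?B"
        unfolding jump_flux_def by (rule Bochner_Integration.integral_add[OF intA intB])
      finally show ?thesis .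
    qed
    moreover have "jump_mass ?k ?A = ennreal (jump_flux ?k ?s ?A)"
    proof (rule jump_mass_eq_flux)
      show "?s z = 1" if "z \<in> ?A" for z
        using that D by (cases z) (force simp: level_sign_def sgn_if)
    qed (use fin in \<open>auto simp: truncate_nonneg level_sign_bound\<close>)
    moreover have "jump_flux ?k (\<lambda>z. - ?s z) ?B \<le> enn2real (jump_mass ?k ?B)"
      by (rule jump_flux_le_mass)
         (use fin in \<open>auto simp: truncate_nonneg level_sign_bound\<close>)
    then have "- jump_flux ?k ?s ?B \<le> enn2real (jump_mass ?k ?B)"
      by (simp add: jump_flux_def)
    ultimately have "jump_mass ?k ?A \<le> ennreal (enn2real (jump_mass ?k ?B))"
      by (simp add: ennreal_leI)
    then show ?thesis using fin by simp
  qed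
  then show "\<exists>N. \<forall>n\<ge>N. jump_mass (truncate_kernel K (1 / real (Suc n))) ?A
      \<le> jump_mass (truncate_kernel K (1 / real (Suc n))) ?B" by simp
qed

lemma jump_mass_pos:
  assumes [measurable]: "A \<in> sets borel" "B \<in> sets borel"
    and pos: "AE z in lborel. 0 < K z"
    and A: "emeasure lborel A \<noteq> 0" and B: "emeasure lborel B \<noteq> 0"
  shows "jump_mass K (A \<times> B) \<noteq> 0"
proof
  assume "jump_mass K (A \<times> B) = 0"
  then have "AE z in lborel \<Otimes>\<^sub>M lborel. ennreal (indicator (A \<times> B) z * K (fst z - snd z)) = 0"
    unfolding jump_mass_def by (subst (asm) nn_integral_0_iff_AE) measurable
  with AE_lborel_pair_diff[OF pos] have "AE z in lborel \<Otimes>\<^sub>M lborel. z \<notin> A \<times> B"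
    by eventually_elim (auto simp: indicator_def split: if_splits)
  then have "emeasure (lborel \<Otimes>\<^sub>M lborel) (A \<times> B) = 0"
    by (subst (asm) AE_iff_null_sets[symmetric]) auto
  then show False using A B by (simp add: lborel.emeasure_pair_measure_Times)
qed

text \<open>
  Removing from \<open>G\<close> a cap \<open>D\<close> contained in \<open>\<Omega>\<close> replaces the interaction of \<open>D\<close> with \<open>- G\<close> by that of \<open>D\<close>
  with \<open>G - D\<close>, which lies in the open half-space. The gain is strict because \<open>D\<close> also interacts with
  the part of this half-space outside \<open>G\<close>.
\<close>

lemma halfspace_cut_decreases:
  assumes G [measurable]: "G \<in> sets borel" and [measurable]: "\<Omega> \<in> sets borel" and "bounded \<Omega>"
    and cap: "G \<inter> {y. c \<le> e \<bullet> y} \<subseteq> \<Omega>"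
    and fin: "jump_mass K (jump_pairs \<Omega> G) < \<infinity>"
    and pos: "AE z in lborel. 0 < K z"
    and cap_pos: "emeasure lborel (G \<inter> {y. c \<le> e \<bullet> y}) \<noteq> 0"
    and rest_pos: "emeasure lborel ({y. e \<bullet> y < c} - G) \<noteq> 0"
  shows "jump_mass K (jump_pairs \<Omega> (G \<inter> {y. e \<bullet> y < c})) < jump_mass K (jump_pairs \<Omega> G)"
proof -
  define H where "H = {y. e \<bullet> y < c}"
  define D where "D = G \<inter> {y. c \<le> e \<bullet> y}"
  have [measurable]: "H \<in> sets borel" "D \<in> sets borel" by (auto simp: H_def D_def)
  \<comment> \<open>The jump pairs of \<open>G\<close> that do not start in the cap are kept by the cut.\<close>
  define R where "R = jump_pairs \<Omega> G \<inter> (- D) \<times> UNIV"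
  have R [measurable]: "R \<in> sets (borel \<Otimes>\<^sub>M borel)" unfolding R_def by measurable
  have "bounded D" using cap \<open>bounded \<Omega>\<close> by (auto simp: D_def intro: bounded_subset)
  have mH: "{y. c \<le> e \<bullet> y} = - H" by (auto simp: H_def)
  have half: "jump_mass K (D \<times> H) \<le> jump_mass K (D \<times> (- H - D))"
    using halfspace_interaction_le[of D c e] \<open>bounded D\<close> by (auto simp: D_def H_def mH)
  have strict: "jump_mass K (D \<times> (H - G)) \<noteq> 0"
    by (rule jump_mass_pos) (use pos cap_pos rest_pos in \<open>auto simp: D_def H_def\<close>)
  have le: "jump_mass K R + jump_mass K (D \<times> (- H - D)) + jump_mass K (D \<times> (H - G))
      \<le> jump_mass K (jump_pairs \<Omega> G)"
  proof -
    have "jump_mass K (R \<union> D \<times> (- H - D) \<union> D \<times> (H - G)) =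
      jump_mass K R + jump_mass K (D \<times> (- H - D)) + jump_mass K (D \<times> (H - G))"
      by (subst jump_mass_Un; (subst jump_mass_Un)?) (auto simp: R_def)
    moreover have "R \<union> D \<times> (- H - D) \<union> D \<times> (H - G) \<subseteq> jump_pairs \<Omega> G"
      using cap by (auto simp: R_def D_def H_def jump_pairs_def)
    ultimately show ?thesis by (metis jump_mass_mono K_nonneg)
  qed
  have "jump_mass K (jump_pairs \<Omega> (G \<inter> H)) \<le> jump_mass K (R \<union> (G \<inter> H) \<times> D)"
    by (rule jump_mass_mono) (auto simp: R_def D_def H_def jump_pairs_def K_nonneg)
  also have "\<dots> = jump_mass K R + jump_mass K ((G \<inter> H) \<times> D)"
    by (rule jump_mass_Un) (auto simp: R_def jump_pairs_def D_def)
  also have "jump_mass K ((G \<inter> H) \<times> D) = jump_mass K (D \<times> (G \<inter> H))"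
    by (rule jump_mass_swap) (auto simp: K_even)
  also have "\<dots> \<le> jump_mass K (D \<times> H)" by (rule jump_mass_mono) (auto simp: K_nonneg)
  also note half
  finally have 1: "jump_mass K (jump_pairs \<Omega> (G \<inter> H))
      \<le> jump_mass K R + jump_mass K (D \<times> (- H - D))" by (simp add: add_left_mono)
  have "jump_mass K R + jump_mass K (D \<times> (- H - D)) < \<infinity>"
    by (rule le_less_trans[OF _ fin], rule order_trans[OF _ le]) simp
  then have 2: "jump_mass K R + jump_mass K (D \<times> (- H - D)) + 0 <
     jump_mass K R + jump_mass K (D \<times> (- H - D)) + jump_mass K (D \<times> (H - G))"
    using strict by (subst ennreal_add_left_cancel_less) (auto simp: zero_less_iff_neq_zero)
  show ?thesis
    unfolding H_def[symmetric]
    using le_less_trans[OF 1 less_le_trans[OF 2[unfolded add_0_right] le]] .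
qed

text \<open>
  The minimality argument. The perimeter of \<open>F\<close> bounds its truncated flux, which is the truncated
  perimeter of \<open>E\<close> plus the curvature correction; only then does the truncation tend to zero.
\<close>

lemma calibrated_mass_le:
  assumes F [measurable]: "F \<in> sets borel" and [measurable]: "\<Omega> \<in> sets borel" "\<phi> \<in> borel_measurable borel"
    and "bounded \<Omega>" and E: "E = {x. 0 < \<phi> x}" and eq: "F - \<Omega> = E - \<Omega>"
    and lim: "(\<lambda>n. curvature_pairing (truncate_kernel K (1 / real (Suc n))) \<phi> F E) \<longlonglongrightarrow> l"
    and l: "0 \<le> l"
  shows "jump_mass K (jump_pairs \<Omega> E) \<le> jump_mass K (jump_pairs \<Omega> F)"
proof (cases "jump_mass K (jump_pairs \<Omega> F) = \<infinity>")
  case False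
  define m where "m = enn2real (jump_mass K (jump_pairs \<Omega> F))"
  have m: "ennreal m = jump_mass K (jump_pairs \<Omega> F)"
    using False by (simp add: m_def less_top)
  define a where "a n = curvature_pairing (truncate_kernel K (1 / real (Suc n))) \<phi> F E" for n
  have Em [measurable]: "E \<in> sets borel" unfolding E by measurable
  have "jump_mass (truncate_kernel K (1 / real (Suc n))) (jump_pairs \<Omega> E) \<le> ennreal (m - a n)" for n
  proof -
    let ?k = "truncate_kernel K (1 / real (Suc n))"
    have e: "0 < 1 / real (Suc n)" by simp
    have "jump_mass ?k (jump_pairs \<Omega> E) = ennreal (jump_flux ?k (level_sign \<phi>) (jump_pairs \<Omega> E))"
      by (rule jump_mass_eq_flux)
         (use jump_mass_truncate_finite[OF e Em _ \<open>bounded \<Omega>\<close>] in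
           \<open>auto simp: truncate_nonneg level_sign_bound jump_pairs_def E level_sign_def sgn_if\<close>)
    also have "jump_flux ?k (level_sign \<phi>) (jump_pairs \<Omega> E) =
        jump_flux ?k (level_sign \<phi>) (jump_pairs \<Omega> F) - a n"
      using truncated_flux_diff[OF F Em _ _ \<open>bounded \<Omega>\<close> eq e] by (simp add: a_def)
    also have "jump_flux ?k (level_sign \<phi>) (jump_pairs \<Omega> F) \<le> enn2real (jump_mass ?k (jump_pairs \<Omega> F))"
      by (rule jump_flux_le_mass)
         (use jump_mass_truncate_finite[OF e F _ \<open>bounded \<Omega>\<close>] in
           \<open>auto simp: truncate_nonneg level_sign_bound\<close>)
    also have "\<dots> \<le> m" unfolding m_def
      by (rule enn2real_mono) (use False jump_mass_truncate_le in \<open>auto simp: less_top\<close>)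
    finally show ?thesis by (simp add: ennreal_leI)
  qed
  moreover have "(\<lambda>n. ennreal (m - a n)) \<longlonglongrightarrow> ennreal (m - l)"
    using lim by (intro tendsto_ennrealI tendsto_diff tendsto_const) (simp add: a_def)
  ultimately have "jump_mass K (jump_pairs \<Omega> E) \<le> ennreal (m - l)"
    by (intro LIMSEQ_le[OF jump_mass_truncate_tendsto]) auto
  also have "\<dots> \<le> ennreal m" using l by (intro ennreal_leI) simp
  finally show ?thesis by (simp add: m)
qed simp

lemma flux_diff_eq_limit:
  assumes F [measurable]: "F \<in> sets borel" and E [measurable]: "E \<in> sets borel"
    and [measurable]: "\<Omega> \<in> sets borel" "\<phi> \<in> borel_measurable borel"
    and "bounded \<Omega>" and eq: "F - \<Omega> = E - \<Omega>"
    and lim: "(\<lambda>n. curvature_pairing (truncate_kernel K (1 / real (Suc n))) \<phi> F E) \<longlonglongrightarrow> l"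
    and fin: "jump_mass K (jump_pairs \<Omega> F) < \<infinity>" "jump_mass K (jump_pairs \<Omega> E) < \<infinity>"
  shows "jump_flux K (level_sign \<phi>) (jump_pairs \<Omega> F) = jump_flux K (level_sign \<phi>) (jump_pairs \<Omega> E) + l"
proof (rule LIMSEQ_unique)
  show "(\<lambda>n. jump_flux (truncate_kernel K (1 / real (Suc n))) (level_sign \<phi>) (jump_pairs \<Omega> F))
      \<longlonglongrightarrow> jump_flux K (level_sign \<phi>) (jump_pairs \<Omega> F)"
    by (rule jump_flux_truncate_tendsto) (use fin in \<open>auto simp: level_sign_bound\<close>)
  have "(\<lambda>n. jump_flux (truncate_kernel K (1 / real (Suc n))) (level_sign \<phi>) (jump_pairs \<Omega> E))
      \<longlonglongrightarrow> jump_flux K (level_sign \<phi>) (jump_pairs \<Omega> E)"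
    by (rule jump_flux_truncate_tendsto) (use fin in \<open>auto simp: level_sign_bound\<close>)
  from tendsto_add[OF this lim]
  show "(\<lambda>n. jump_flux (truncate_kernel K (1 / real (Suc n))) (level_sign \<phi>) (jump_pairs \<Omega> F))
      \<longlonglongrightarrow> jump_flux K (level_sign \<phi>) (jump_pairs \<Omega> E) + l"
    using truncated_flux_diff[OF F E _ _ \<open>bounded \<Omega>\<close> eq] by simp
qed

lemma equal_mass_imp_ordered:
  assumes F [measurable]: "F \<in> sets borel" and [measurable]: "\<Omega> \<in> sets borel" "\<phi> \<in> borel_measurable borel"
    and "bounded \<Omega>" and E: "E = {x. 0 < \<phi> x}" and eq: "F - \<Omega> = E - \<Omega>"
    and lim: "(\<lambda>n. curvature_pairing (truncate_kernel K (1 / real (Suc n))) \<phi> F E) \<longlonglongrightarrow> l"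
    and l: "0 \<le> l"
    and fin: "jump_mass K (jump_pairs \<Omega> F) < \<infinity>"
    and same: "jump_mass K (jump_pairs \<Omega> F) = jump_mass K (jump_pairs \<Omega> E)"
    and pos: "AE z in lborel. 0 < K z"
  shows "AE z in lborel \<Otimes>\<^sub>M lborel. z \<in> jump_pairs \<Omega> F \<longrightarrow> \<phi> (snd z) < \<phi> (fst z)"
proof -
  have Em [measurable]: "E \<in> sets borel" unfolding E by measurable
  have "jump_mass K (jump_pairs \<Omega> E) = ennreal (jump_flux K (level_sign \<phi>) (jump_pairs \<Omega> E))"
    by (rule jump_mass_eq_flux)
       (use fin same in \<open>auto simp: K_nonneg level_sign_bound jump_pairs_def E level_sign_def sgn_if\<close>)
  moreover have "0 \<le> jump_flux K (level_sign \<phi>) (jump_pairs \<Omega> E)"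
    unfolding jump_flux_def
    by (rule integral_nonneg_AE) (auto simp: K_nonneg jump_pairs_def E level_sign_def sgn_if indicator_def)
  moreover have "jump_flux K (level_sign \<phi>) (jump_pairs \<Omega> F) =
      jump_flux K (level_sign \<phi>) (jump_pairs \<Omega> E) + l"
    by (rule flux_diff_eq_limit[OF F Em _ _ \<open>bounded \<Omega>\<close> eq lim]) (use fin same in auto)
  ultimately have ge: "enn2real (jump_mass K (jump_pairs \<Omega> F)) \<le> jump_flux K (level_sign \<phi>) (jump_pairs \<Omega> F)"
    using l same by simp
  have le: "jump_flux K (level_sign \<phi>) (jump_pairs \<Omega> F) \<le> enn2real (jump_mass K (jump_pairs \<Omega> F))"
    by (rule jump_flux_le_mass) (use fin in \<open>auto simp: K_nonneg level_sign_bound\<close>)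
  have "AE z in lborel \<Otimes>\<^sub>M lborel. z \<in> jump_pairs \<Omega> F \<longrightarrow> 0 < K (fst z - snd z) \<longrightarrow> level_sign \<phi> z = 1"
    by (rule jump_flux_le_mass(2)) (use fin le ge in \<open>auto simp: K_nonneg level_sign_bound\<close>)
  with AE_lborel_pair_diff[OF pos] show ?thesis
    by eventually_elim (auto simp: level_sign_def sgn_if split: if_splits)
qed

end

section \<open>Borel representatives\<close>

lemma lebesgue_set_borel_representative:
  assumes "A \<in> sets lebesgue"
  obtains B where "B \<in> sets borel" "AE x in lborel. x \<in> A \<longleftrightarrow> x \<in> B"
proof
  show "main_part lborel A \<in> sets borel" using main_part_sets[OF assms] by simp
  show "AE x in lborel. x \<in> A \<longleftrightarrow> x \<in> main_part lborel A"
    using AE_notin_null_part[OF assms]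
  proof eventually_elim
    case (elim x)
    then show ?case using main_part_null_part_Un[OF assms] by blast
  qed
qed

lemma competitor_borel_representative:
  assumes "F \<in> sets lebesgue" and [measurable]: "\<Omega> \<in> sets borel" "E' \<in> sets borel"
    and "F - \<Omega> = E - \<Omega>" and "AE x in lborel. x \<in> E \<longleftrightarrow> x \<in> E'"
  obtains F' where "F' \<in> sets borel" "AE x in lborel. x \<in> F \<longleftrightarrow> x \<in> F'" "F' - \<Omega> = E' - \<Omega>"
proof -
  obtain B where B [measurable]: "B \<in> sets borel" "AE x in lborel. x \<in> F \<longleftrightarrow> x \<in> B"
    using lebesgue_set_borel_representative[OF assms(1)] by blast
  show ?thesis
  proof
    show "(B \<inter> \<Omega>) \<union> (E' - \<Omega>) \<in> sets borel" by measurable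
    show "AE x in lborel. x \<in> F \<longleftrightarrow> x \<in> (B \<inter> \<Omega>) \<union> (E' - \<Omega>)"
      using B(2) assms(5) by eventually_elim (use assms(4) in blast)
  qed auto
qed

lemma kernel_borel_representative:
  fixes K :: "'a::euclidean_space \<Rightarrow> real"
  assumes K: "K \<in> borel_measurable lebesgue"
    and nonneg: "\<And>z. K z \<ge> 0" and even: "\<And>z. K (- z) = K z"
    and int: "integrable lebesgue (\<lambda>z. min 1 (norm z) * K z)"
  obtains K' where "nonlocal_kernel K'" "AE z in lborel. K z = K' z"
proof -
  obtain k where k [measurable]: "k \<in> borel_measurable borel" and Kk: "AE z in lborel. K z = k z"
    using completion_ex_borel_measurable_real[OF K] by auto
  \<comment> \<open>The Borel representative \<open>k\<close> is even and nonnegative only almost everywhere; symmetrizing and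
    taking the positive part repair this.\<close>
  define K' where "K' z = max 0 ((k z + k (- z)) / 2)" for z
  have [measurable]: "K' \<in> borel_measurable borel" unfolding K'_def[abs_def] by measurable
  have "AE z in lborel. K (0 - z) = k (0 - z)" by (rule AE_lborel_reflect[OF Kk])
  with Kk have eq: "AE z in lborel. K z = K' z"
  proof eventually_elim
    case (elim z)
    then show ?case using nonneg[of z] by (simp add: K'_def even)
  qed
  have m: "(\<lambda>z. min 1 (norm z) * K' z) \<in> borel_measurable lborel" by measurable
  have "integrable lebesgue (\<lambda>z. min 1 (norm z) * K' z)"
    by (rule integrable_cong_AE_imp[OF int])
       (use m eq in \<open>auto intro: measurable_completion simp: AE_completion_iff\<close>)
  then have "integrable lborel (\<lambda>z. min 1 (norm z) * K' z)"
    by (simp add: integrable_completion[OF m])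
  then have "nonlocal_kernel K'"
    by unfold_locales (auto simp: K'_def add.commute)
  with eq that show ?thesis by blast
qed

lemma interaction_representative:
  fixes K K' :: "real^'n \<Rightarrow> real"
  assumes "nonlocal_kernel K'" and K: "AE z in lborel. K z = K' z"
    and [measurable]: "A' \<in> sets borel" and A: "AE x in lborel. x \<in> A \<longleftrightarrow> x \<in> A'"
    and [measurable]: "B' \<in> sets borel" and B: "AE x in lborel. x \<in> B \<longleftrightarrow> x \<in> B'"
  shows "interaction K A B = jump_mass K' (A' \<times> B')"
proof -
  interpret nonlocal_kernel K' by fact
  have inner: "(\<integral>\<^sup>+y\<in>B. ennreal (K (x - y)) \<partial>lebesgue) = (\<integral>\<^sup>+y. ennreal (K' (x - y)) * indicator B' y \<partial>lborel)" for x
    unfolding nn_integral_completion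
    by (rule nn_integral_cong_AE)
       (use AE_lborel_reflect[OF K, of x] B in eventually_elim, simp add: indicator_def)
  have "interaction K A B = (\<integral>\<^sup>+x. (\<integral>\<^sup>+y. ennreal (K' (x - y)) * indicator B' y \<partial>lborel) * indicator A' x \<partial>lborel)"
    unfolding interaction_def unfolding inner unfolding nn_integral_completion
    by (rule nn_integral_cong_AE) (use A in eventually_elim, simp add: indicator_def)
  also have "\<dots> = (\<integral>\<^sup>+x. \<integral>\<^sup>+y. ennreal (indicator (A' \<times> B') (x, y) * K' (fst (x, y) - snd (x, y))) \<partial>lborel \<partial>lborel)"
    by (intro nn_integral_cong) (auto simp: indicator_def intro!: nn_integral_cong)
  also have "\<dots> = jump_mass K' (A' \<times> B')"
    unfolding jump_mass_def by (rule lborel.nn_integral_fst) measurable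
  finally show ?thesis .
qed

lemma perimeter_in_representative:
  fixes K K' :: "real^'n \<Rightarrow> real"
  assumes "nonlocal_kernel K'" and K: "AE z in lborel. K z = K' z"
    and [measurable]: "F' \<in> sets borel" and F: "AE x in lborel. x \<in> F \<longleftrightarrow> x \<in> F'"
    and [measurable]: "\<Omega> \<in> sets borel"
  shows "perimeter_in K \<Omega> F = jump_mass K' (jump_pairs \<Omega> F')"
proof -
  interpret nonlocal_kernel K' by fact
  let ?A = "(F' \<inter> \<Omega>) \<times> (- F' \<inter> \<Omega>)" and ?B = "(F' \<inter> \<Omega>) \<times> (- F' \<inter> - \<Omega>)"
    and ?C = "(F' \<inter> - \<Omega>) \<times> (- F' \<inter> \<Omega>)"
  have "perimeter_in K \<Omega> F = jump_mass K' ?A + jump_mass K' ?B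
      + jump_mass K' ((- F' \<inter> \<Omega>) \<times> (F' \<inter> - \<Omega>))"
    unfolding perimeter_in_def
    by (intro arg_cong2[where f="(+)"] interaction_representative[OF assms(1) K])
       (use F in \<open>auto elim: eventually_mono\<close>)
  also have "jump_mass K' ((- F' \<inter> \<Omega>) \<times> (F' \<inter> - \<Omega>)) = jump_mass K' ?C"
    by (rule jump_mass_swap) (auto simp: K_even)
  also have "jump_mass K' ?A + jump_mass K' ?B + jump_mass K' ?C = jump_mass K' (?A \<union> ?B \<union> ?C)"
    by (subst jump_mass_Un; (subst jump_mass_Un)?) auto
  also have "?A \<union> ?B \<union> ?C = jump_pairs \<Omega> F'" by (auto simp: jump_pairs_def)
  finally show ?thesis .
qed

text \<open>
  The factor 2 appears because the calibration integrates over both orderings of each separated pair.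
\<close>

lemma calibration_representative:
  fixes K K' \<phi> \<phi>' :: "real^'n \<Rightarrow> real"
  assumes "nonlocal_kernel K'" and K: "AE z in lborel. K z = K' z"
    and [measurable]: "F' \<in> sets borel" and F: "AE x in lborel. x \<in> F \<longleftrightarrow> x \<in> F'"
    and [measurable]: "\<phi>' \<in> borel_measurable borel" and \<phi>: "AE x in lborel. \<phi> x = \<phi>' x"
    and [measurable]: "\<Omega> \<in> sets borel"
    and fin: "jump_mass K' (jump_pairs \<Omega> F') < \<infinity>"
  shows "calibration K \<Omega> \<phi> F = 2 * jump_flux K' (level_sign \<phi>') (jump_pairs \<Omega> F')"
proof -
  interpret nonlocal_kernel K' by fact
  let ?L = "lborel \<Otimes>\<^sub>M lborel :: ((real^'n) \<times> (real^'n)) measure"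
  define f where "f z = indicator (jump_pairs \<Omega> F') z * (level_sign \<phi>' z * K' (fst z - snd z))" for z
  have f: "integrable ?L f" unfolding f_def
    by (rule jump_mass_finite_imp_integrable) (use fin in \<open>auto simp: K_nonneg level_sign_bound\<close>)
  have [measurable]: "f \<in> borel_measurable ?L" using f by auto
  define g where "g = (\<lambda>z. f z + f (prod.swap z))"
  have g: "g \<in> borel_measurable ?L" unfolding g_def using f integrable_lborel_pair_swap[OF f] by auto
  define h where "h z = indicator (UNIV - (- \<Omega>) \<times> (- \<Omega>)) z *\<^sub>R
      (case z of (x, y) \<Rightarrow> sgn (\<phi> x - \<phi> y) * (indicator F x - indicator F y) * K (x - y))" for z
  have "AE z in ?L. g z = h z"
    using AE_lborel_pair_fst[OF \<phi>] AE_lborel_pair_snd[OF \<phi>] AE_lborel_pair_fst[OF F]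
      AE_lborel_pair_snd[OF F] AE_lborel_pair_diff[OF K]
  proof eventually_elim
    case (elim z)
    have "K' (snd z - fst z) = K' (fst z - snd z)"
      using K_even[of "fst z - snd z"] by simp
    moreover have "level_sign \<phi>' (prod.swap z) = - level_sign \<phi>' z" by (rule level_sign_swap)
    moreover have "sgn (\<phi>' (fst z) - \<phi>' (snd z)) = level_sign \<phi>' z" by (simp add: level_sign_def)
    ultimately show ?case using elim
      by (cases z) (auto simp: h_def g_def f_def jump_pairs_def indicator_def)
  qed
  then have AE: "AE z in lebesgue. g z = h z"
    unfolding lborel_prod AE_completion_iff .
  have gl: "g \<in> borel_measurable lebesgue"
    using g by (simp add: lborel_prod measurable_completion)
  have "calibration K \<Omega> \<phi> F = integral\<^sup>L lebesgue h"
    unfolding calibration_def set_lebesgue_integral_def h_def ..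
  also have "\<dots> = integral\<^sup>L lebesgue g"
    by (rule integral_cong_AE) (use gl AE borel_measurable_AE[OF gl AE] in \<open>auto simp: eq_commute\<close>)
  also have "\<dots> = integral\<^sup>L ?L g"
    using g by (simp add: lborel_prod integral_completion)
  also have "\<dots> = 2 * jump_flux K' (level_sign \<phi>') (jump_pairs \<Omega> F')"
    unfolding g_def using f
    by (simp add: integrable_lborel_pair_swap integral_lborel_pair_swap)
       (simp add: jump_flux_def f_def[abs_def])
  finally show ?thesis .
qed

text \<open>
  The points \<open>x\<close> where this applies do not depend on \<open>\<epsilon>\<close>, so one null set serves for all truncations.
\<close>

lemma truncated_curvature_representative:
  fixes K K' \<phi> \<phi>' :: "real^'n \<Rightarrow> real"
  assumes "nonlocal_kernel K'" and K: "AE z in lborel. K z = K' z"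
    and [measurable]: "\<phi>' \<in> borel_measurable borel" and \<phi>: "AE x in lborel. \<phi> x = \<phi>' x"
    and x: "\<phi> x = \<phi>' x"
  shows "truncated_curvature K \<phi> \<epsilon> x = (\<integral>y. sgn (\<phi>' x - \<phi>' y) * truncate_kernel K' \<epsilon> (x - y) \<partial>lborel)"
proof -
  interpret nonlocal_kernel K' by fact
  define g where "g = (\<lambda>y. sgn (\<phi>' x - \<phi>' y) * truncate_kernel K' \<epsilon> (x - y))"
  define h where "h y = indicator (- ball x \<epsilon>) y *\<^sub>R (sgn (\<phi> x - \<phi> y) * K (x - y))" for y
  have g: "g \<in> borel_measurable lborel" unfolding g_def by measurable
  have gl: "g \<in> borel_measurable lebesgue" using g by (rule measurable_completion)
  have "AE y in lborel. g y = h y"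
    using AE_lborel_reflect[OF K, of x] \<phi>
    by eventually_elim (simp add: g_def h_def x truncate_kernel_def indicator_def dist_norm)
  then have AE: "AE y in lebesgue. g y = h y" by (simp add: AE_completion_iff)
  have "truncated_curvature K \<phi> \<epsilon> x = integral\<^sup>L lebesgue h"
    unfolding truncated_curvature_def set_lebesgue_integral_def h_def ..
  also have "\<dots> = integral\<^sup>L lebesgue g"
    by (rule integral_cong_AE) (use gl AE borel_measurable_AE[OF gl AE] in \<open>auto simp: eq_commute\<close>)
  also have "\<dots> = integral\<^sup>L lborel g" by (rule integral_completion[OF g])
  finally show ?thesis by (simp add: g_def)
qed

lemma curvature_pairing_tendsto:
  fixes K K' \<phi> \<phi>' :: "real^'n \<Rightarrow> real"
  assumes "nonlocal_kernel K'" and K: "AE z in lborel. K z = K' z"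
    and [measurable]: "\<phi>' \<in> borel_measurable borel" and \<phi>: "AE x in lborel. \<phi> x = \<phi>' x"
    and [measurable]: "F' \<in> sets borel" and F: "AE x in lborel. x \<in> F \<longleftrightarrow> x \<in> F'"
    and [measurable]: "E' \<in> sets borel" and E: "AE x in lborel. x \<in> E \<longleftrightarrow> x \<in> E'"
    and eq: "F - \<Omega> = E - \<Omega>" and meas: "F \<in> sets lebesgue" "E \<in> sets lebesgue"
    and conv: "converges_in_L1_on \<Omega> (truncated_curvature K \<phi>) H (at_right 0)"
  shows "(\<lambda>n. curvature_pairing (truncate_kernel K' (1 / real (Suc n))) \<phi>' F' E')
     \<longlonglongrightarrow> (\<integral>x. (indicator F x - indicator E x) * H x \<partial>lebesgue)"
proof -
  interpret nonlocal_kernel K' by fact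
  define T where "T n = truncated_curvature K \<phi> (1 / real (Suc n))" for n
  define d where "d = (\<lambda>x. indicator F x - indicator E x :: real)"
  have fl: "filterlim (\<lambda>n. 1 / real (Suc n)) (at_right 0) sequentially"
    by (intro tendsto_imp_filterlim_at_right LIMSEQ_Suc[OF lim_1_over_n] always_eventually) simp
  have Tint: "\<forall>\<^sub>F n in sequentially. set_integrable lebesgue \<Omega> (T n)"
    and Hint: "set_integrable lebesgue \<Omega> H"
    and Tlim: "(\<lambda>n. LINT x : \<Omega> | lebesgue. \<bar>T n x - H x\<bar>) \<longlonglongrightarrow> 0"
    using conv eventually_compose_filterlim[OF _ fl] filterlim_compose[OF _ fl]
    unfolding converges_in_L1_on_def T_def by blast+
  have d: "d x = indicator \<Omega> x * d x" "\<bar>d x\<bar> \<le> 1" for x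
    using eq by (auto simp: d_def indicator_def)
  have dm [measurable]: "d \<in> borel_measurable lebesgue" unfolding d_def using meas by measurable
  have dint: "integrable lebesgue (\<lambda>x. d x * f x)" if f: "set_integrable lebesgue \<Omega> f" for f :: "_ \<Rightarrow> real"
  proof (rule Bochner_Integration.integrable_bound)
    have f': "integrable lebesgue (\<lambda>x. indicator \<Omega> x * f x)"
      using f by (simp add: set_integrable_def)
    show "integrable lebesgue (\<lambda>x. indicator \<Omega> x * f x)" by fact
    have "(\<lambda>x. d x * (indicator \<Omega> x * f x)) \<in> borel_measurable lebesgue"
      by (rule borel_measurable_times[OF dm borel_measurable_integrable[OF f']])
    then show "(\<lambda>x. d x * f x) \<in> borel_measurable lebesgue"
      by (rule measurable_cong[THEN iffD1, rotated]) (metis d(1) mult.assoc mult.commute)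
    show "AE x in lebesgue. norm (d x * f x) \<le> norm (indicator \<Omega> x * f x)"
    proof (rule AE_I2)
      fix x
      have "norm (d x * f x) = \<bar>d x\<bar> * norm (indicator \<Omega> x * f x)"
        by (subst d(1)) (simp add: abs_mult)
      also have "\<dots> \<le> 1 * norm (indicator \<Omega> x * f x)" by (intro mult_right_mono d(2)) auto
      finally show "norm (d x * f x) \<le> norm (indicator \<Omega> x * f x)" by simp
    qed
  qed
  have "(\<lambda>n. (\<integral>x. d x * T n x \<partial>lebesgue) - (\<integral>x. d x * H x \<partial>lebesgue)) \<longlonglongrightarrow> 0"
  proof (rule Lim_null_comparison[OF _ Tlim])
    show "\<forall>\<^sub>F n in sequentially. norm ((\<integral>x. d x * T n x \<partial>lebesgue) - (\<integral>x. d x * H x \<partial>lebesgue))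
        \<le> (LINT x : \<Omega> | lebesgue. \<bar>T n x - H x\<bar>)"
      using Tint
    proof eventually_elim
      case (elim n)
      have di: "set_integrable lebesgue \<Omega> (\<lambda>x. T n x - H x)"
        using elim Hint by (rule set_integral_diff)
      have "(\<integral>x. d x * T n x \<partial>lebesgue) - (\<integral>x. d x * H x \<partial>lebesgue) = (\<integral>x. d x * (T n x - H x) \<partial>lebesgue)"
        using dint[OF elim] dint[OF Hint] by (simp add: right_diff_distrib)
      also have "norm \<dots> \<le> (\<integral>x. norm (d x * (T n x - H x)) \<partial>lebesgue)"
        by (rule integral_norm_bound)
      also have "\<dots> \<le> (\<integral>x. indicator \<Omega> x *\<^sub>R \<bar>T n x - H x\<bar> \<partial>lebesgue)"
      proof (rule integral_mono)
        show "integrable lebesgue (\<lambda>x. norm (d x * (T n x - H x)))"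
          using dint[OF di] by (rule integrable_norm)
        show "integrable lebesgue (\<lambda>x. indicator \<Omega> x *\<^sub>R \<bar>T n x - H x\<bar>)"
          using set_integrable_abs[OF di] by (simp add: set_integrable_def)
        fix x
        have "norm (d x * (T n x - H x)) = \<bar>d x\<bar> * (indicator \<Omega> x *\<^sub>R \<bar>T n x - H x\<bar>)"
          by (subst d(1)) (simp add: abs_mult)
        also have "\<dots> \<le> 1 * (indicator \<Omega> x *\<^sub>R \<bar>T n x - H x\<bar>)" by (intro mult_right_mono d(2)) auto
        finally show "norm (d x * (T n x - H x)) \<le> indicator \<Omega> x *\<^sub>R \<bar>T n x - H x\<bar>" by simp
      qed
      finally show ?case by (simp add: set_lebesgue_integral_def)
    qed
  qed
  then have "(\<lambda>n. \<integral>x. d x * T n x \<partial>lebesgue) \<longlonglongrightarrow> (\<integral>x. d x * H x \<partial>lebesgue)"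
    by (rule LIM_zero_cancel)
  moreover have "(\<integral>x. d x * T n x \<partial>lebesgue) = curvature_pairing (truncate_kernel K' (1 / real (Suc n))) \<phi>' F' E'" for n
  proof -
    define g where "g x = (indicator F' x - indicator E' x) *
          (\<integral>y. sgn (\<phi>' x - \<phi>' y) * truncate_kernel K' (1 / real (Suc n)) (x - y) \<partial>lborel)" for x
    have g: "g \<in> borel_measurable lborel" unfolding g_def[abs_def] by measurable
    have gl: "g \<in> borel_measurable lebesgue" using g by (rule measurable_completion)
    have "AE x in lborel. g x = d x * T n x"
      using F E \<phi>
      by eventually_elim
         (simp add: g_def d_def T_def indicator_def
            truncated_curvature_representative[OF assms(1) K assms(3) \<phi>])
    then have AE: "AE x in lebesgue. g x = d x * T n x" by (simp add: AE_completion_iff)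
    have "(\<integral>x. d x * T n x \<partial>lebesgue) = integral\<^sup>L lebesgue g"
      by (rule integral_cong_AE) (use gl AE borel_measurable_AE[OF gl AE] in \<open>auto simp: eq_commute\<close>)
    also have "\<dots> = integral\<^sup>L lborel g" by (rule integral_completion[OF g])
    finally show ?thesis unfolding g_def[abs_def] curvature_pairing_def .
  qed
  ultimately show ?thesis by (simp add: d_def)
qed

section \<open>Uniqueness of the minimizer\<close>

lemma open_not_AE:
  fixes U :: "'a::euclidean_space set"
  assumes "open U" "x \<in> U"
  shows "\<not> (AE x in lborel. x \<notin> U)"
proof
  assume "AE x in lborel. x \<notin> U"
  then have "U \<in> null_sets lborel"
    using assms by (subst AE_iff_null_sets) auto
  then have "negligible U"
    by (simp add: negligible_iff_null_sets null_sets_completionI)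
  then show False using open_not_negligible assms by blast
qed

text \<open>
  In dimension at least two the complement of a closed bounded convex set is connected, so \<open>\<phi>\<close> takes
  all intermediate values there; by continuity it does so on a set of positive measure.
\<close>

lemma exterior_intermediate_value:
  fixes \<phi> :: "'a::euclidean_space \<Rightarrow> real"
  assumes cont: "continuous_on UNIV \<phi>" and dim: "2 \<le> DIM('a)"
    and B: "bounded B" "convex B" "closed B"
    and pq: "p \<notin> B" "q \<notin> B" "a < \<phi> p" "\<phi> q < b" "a < b"
  shows "\<not> (AE x in lborel. x \<notin> B \<longrightarrow> \<phi> x \<le> a \<or> b \<le> \<phi> x)"
proof -
  have "\<exists>r. r \<notin> B \<and> a < \<phi> r \<and> \<phi> r < b"
  proof (cases "a < \<phi> q \<or> \<phi> p < b")
    case False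
    have "connected (\<phi> ` (- B))"
      using connected_complement_bounded_convex[OF B(1,2) dim] cont
      by (intro connected_continuous_image) (auto intro: continuous_on_subset)
    then have "(a + b) / 2 \<in> \<phi> ` (- B)"
      by (rule connectedD_interval[of _ "\<phi> q" "\<phi> p"]) (use False pq in \<open>auto simp: field_simps\<close>)
    then show ?thesis using pq by (force simp: field_simps)
  qed (use pq in auto)
  then obtain r where r: "r \<notin> B" "a < \<phi> r" "\<phi> r < b" by blast
  have "open (- B \<inter> {x. a < \<phi> x} \<inter> {x. \<phi> x < b})"
    using B cont by (intro open_Int open_Compl open_Collect_less) (auto intro: continuous_on_const)
  from open_not_AE[OF this, of r] r
  have *: "\<not> (AE x in lborel. x \<notin> - B \<inter> {x. a < \<phi> x} \<inter> {x. \<phi> x < b})" by simp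
  show ?thesis
  proof
    assume "AE x in lborel. x \<notin> B \<longrightarrow> \<phi> x \<le> a \<or> b \<le> \<phi> x"
    then have "AE x in lborel. x \<notin> - B \<inter> {x. a < \<phi> x} \<inter> {x. \<phi> x < b}"
      by eventually_elim auto
    with * show False by blast
  qed
qed

text \<open>
  For a positive kernel and continuous \<open>\<phi>\<close> there is no essentially bounded, non-null minimizer \<open>G\<close> of
  finite perimeter that contains \<open>{\<phi> > \<sigma>}\<close> up to a null set and whose part outside \<open>\<Omega>\<close> stays in \<open>{\<phi> \<ge> \<sigma>'}\<close> with \<open>\<sigma>' > \<sigma>\<close>. The gap between the two levels keeps \<open>G - \<Omega>\<close>
  away from the extreme points of \<open>G\<close> in a given direction \<open>e\<close>, so a small cap of \<open>G\<close> can be cut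
  off without changing the exterior datum.
\<close>

lemma minimizer_cap_contradiction:
  fixes K \<phi> :: "real^'n \<Rightarrow> real"
  assumes ker: "nonlocal_kernel K'" and K: "AE z in lborel. K z = K' z"
    and pos: "\<And>z. 0 < K z"
    and \<Omega>: "open \<Omega>" "bounded \<Omega>"
    and min: "perimeter_minimizer K \<Omega> G" and fin: "perimeter_in K \<Omega> G < \<infinity>"
    and cont: "continuous_on UNIV \<phi>"
    and bdd: "AE x in lborel. x \<in> G \<longrightarrow> norm x \<le> r"
    and nonnull: "\<not> (AE x in lborel. x \<notin> G)"
    and super: "AE x in lborel. \<sigma> < \<phi> x \<longrightarrow> x \<in> G"
    and ext: "AE x in lborel. x \<in> G - \<Omega> \<longrightarrow> \<sigma>' \<le> \<phi> x"
    and less: "\<sigma> < \<sigma>'"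
  shows False
proof -
  interpret nonlocal_kernel K' by fact
  obtain e :: "real^'n" where e: "e \<in> Basis" using nonempty_Basis by blast
  then have ne: "norm e = 1" and ee: "e \<bullet> e = 1" by auto
  have enorm: "\<bar>e \<bullet> x\<bar> \<le> norm x" for x using Cauchy_Schwarz_ineq2[of e x] ne by simp
  \<comment> \<open>\<open>c\<close> is the essential supremum of \<open>e \<bullet> x\<close> over \<open>G\<close>.\<close>
  define S where "S = {c. AE x in lborel. x \<in> G \<longrightarrow> e \<bullet> x \<le> c}"
  define c where "c = Inf S"
  have rS: "r \<in> S" unfolding S_def mem_Collect_eq
    using bdd
  proof eventually_elim
    case (elim x)
    then show ?case using enorm[of x] by auto
  qed
  have up: "y \<in> S" if "x \<in> S" "x \<le> y" for x y
    using that unfolding S_def mem_Collect_eq by (elim eventually_mono) auto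
  have lower: "- r \<le> x" if "x \<in> S" for x
  proof (rule ccontr)
    assume "\<not> - r \<le> x"
    have "AE y in lborel. y \<notin> G"
      using bdd that[unfolded S_def mem_Collect_eq]
    proof eventually_elim
      case (elim y)
      then show ?case using enorm[of y] \<open>\<not> - r \<le> x\<close> by auto
    qed
    with nonnull show False by blast
  qed
  have bb: "bdd_below S" using lower by (rule bdd_belowI)
  have below: "x \<notin> S" if "x < c" for x
    using that cInf_lower[OF _ bb, of x] by (auto simp: c_def)
  have above: "x \<in> S" if "c < x" for x
    using cInf_lessD[of S x] that rS up unfolding c_def by (metis empty_iff less_imp_le)
  have G_le_c: "AE x in lborel. x \<in> G \<longrightarrow> e \<bullet> x \<le> c"
  proof -
    have "AE x in lborel. \<forall>n. x \<in> G \<longrightarrow> e \<bullet> x \<le> c + 1 / real (Suc n)"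
      unfolding AE_all_countable using above[of "c + 1 / real (Suc n)" for n] by (simp add: S_def)
    then show ?thesis
    proof eventually_elim
      case (elim x)
      show ?case
      proof
        assume "x \<in> G"
        with elim have "e \<bullet> x \<le> c + 1 / real (Suc n)" for n by blast
        moreover have "(\<lambda>n. c + 1 / real (Suc n)) \<longlonglongrightarrow> c + 0"
          by (intro tendsto_add tendsto_const LIMSEQ_Suc[OF lim_1_over_n])
        ultimately show "e \<bullet> x \<le> c" by (auto intro: LIMSEQ_le_const)
      qed
    qed
  qed
  have "\<exists>n. AE x in lborel. x \<in> G \<longrightarrow> c - 1 / real (Suc n) \<le> e \<bullet> x \<longrightarrow> x \<in> \<Omega>"
  proof (rule ccontr)
    assume *: "\<not> ?thesis"
    \<comment> \<open>Points of \<open>G - \<Omega>\<close> in ever thinner caps accumulate at a point \<open>l\<close> with \<open>e \<bullet> l \<ge> c\<close> and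
      \<open>\<phi> l > \<sigma>\<close>. Near \<open>l\<close> the set \<open>G\<close> then has full measure and reaches strictly beyond height \<open>c\<close>.\<close>
    have "\<exists>x. c - 1 / real (Suc n) \<le> e \<bullet> x \<and> norm x \<le> r \<and> \<sigma>' \<le> \<phi> x" for n
    proof (rule ccontr)
      assume no: "\<nexists>x. c - 1 / real (Suc n) \<le> e \<bullet> x \<and> norm x \<le> r \<and> \<sigma>' \<le> \<phi> x"
      have "AE x in lborel. x \<in> G \<longrightarrow> c - 1 / real (Suc n) \<le> e \<bullet> x \<longrightarrow> x \<in> \<Omega>"
        using bdd ext by eventually_elim (use no in blast)
      with * show False by blast
    qed
    then obtain p where p: "\<And>n. c - 1 / real (Suc n) \<le> e \<bullet> p n" "\<And>n. norm (p n) \<le> r" "\<And>n. \<sigma>' \<le> \<phi> (p n)"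
      by metis
    have "compact (cball (0::real^'n) r)" by simp
    then obtain l s where "strict_mono s" and lim: "(p \<circ> s) \<longlonglongrightarrow> l"
      unfolding compact_def using p(2) by (metis mem_cball_0)
    have "\<sigma>' \<le> \<phi> l"
    proof (rule LIMSEQ_le_const)
      show "(\<lambda>n. \<phi> ((p \<circ> s) n)) \<longlonglongrightarrow> \<phi> l"
        by (rule continuous_on_tendsto_compose[OF cont lim]) auto
    qed (use p(3) in auto)
    have cl: "c \<le> e \<bullet> l"
    proof (rule LIMSEQ_le)
      show "(\<lambda>n. e \<bullet> (p \<circ> s) n) \<longlonglongrightarrow> e \<bullet> l" by (intro tendsto_intros lim)
      have "(\<lambda>n. 1 / real (Suc n)) \<longlonglongrightarrow> 0" by (rule LIMSEQ_Suc[OF lim_1_over_n])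
      from LIMSEQ_subseq_LIMSEQ[OF this \<open>strict_mono s\<close>]
      have "(\<lambda>n. c - 1 / real (Suc (s n))) \<longlonglongrightarrow> c - 0"
        by (intro tendsto_diff tendsto_const) (simp add: o_def)
      then show "(\<lambda>n. c - 1 / real (Suc (s n))) \<longlonglongrightarrow> c" by simp
    qed (use p(1) in auto)
    define U where "U = {x. \<sigma> < \<phi> x} \<inter> {x. c < e \<bullet> x}"
    have op: "open {x. \<sigma> < \<phi> x}" using cont by (intro open_Collect_less continuous_on_const)
    have "open U" unfolding U_def
      by (intro open_Int op open_Collect_less continuous_intros)
    have "l \<in> {x. \<sigma> < \<phi> x}" using \<open>\<sigma>' \<le> \<phi> l\<close> less by simp
    with op obtain t where t: "0 < t" "cball l t \<subseteq> {x. \<sigma> < \<phi> x}"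
      unfolding open_contains_cball by blast
    have "l + t *\<^sub>R e \<in> U"
      using t cl ne ee by (auto simp: U_def dist_norm inner_add_right subset_iff)
    from open_not_AE[OF \<open>open U\<close> this] have "\<not> (AE x in lborel. x \<notin> U)" .
    moreover have "AE x in lborel. x \<notin> U"
      using super G_le_c by eventually_elim (auto simp: U_def)
    ultimately show False by blast
  qed
  then obtain n where n: "AE x in lborel. x \<in> G \<longrightarrow> c - 1 / real (Suc n) \<le> e \<bullet> x \<longrightarrow> x \<in> \<Omega>" by blast
  define d where "d = c - 1 / real (Suc n)"
  have dS: "d \<notin> S" by (rule below) (simp add: d_def)
  have Gm: "G \<in> sets lebesgue" using min by (simp add: perimeter_minimizer_def)
  have \<Omega>m [measurable]: "\<Omega> \<in> sets borel" using \<Omega> by simp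
  obtain B where B [measurable]: "B \<in> sets borel" and GB: "AE x in lborel. x \<in> G \<longleftrightarrow> x \<in> B"
    using lebesgue_set_borel_representative[OF Gm] by blast
  \<comment> \<open>Discarding a null set makes the cap a subset of \<open>\<Omega>\<close> exactly.\<close>
  define G' where "G' = B - ({x. d \<le> e \<bullet> x} - \<Omega>)"
  have G'm [measurable]: "G' \<in> sets borel" unfolding G'_def by measurable
  have GG': "AE x in lborel. x \<in> G \<longleftrightarrow> x \<in> G'"
    using GB n by eventually_elim (auto simp: G'_def d_def)
  have Hm: "G' \<inter> {x. e \<bullet> x < d} \<in> sets borel" by measurable
  have "perimeter_in K \<Omega> G = jump_mass K' (jump_pairs \<Omega> G')"
    by (rule perimeter_in_representative[OF ker K G'm GG' \<Omega>m])
  moreover have "perimeter_in K \<Omega> (G - ({x. d \<le> e \<bullet> x} \<inter> \<Omega>)) = jump_mass K' (jump_pairs \<Omega> (G' \<inter> {x. e \<bullet> x < d}))"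
  proof (rule perimeter_in_representative[OF ker K Hm _ \<Omega>m])
    show "AE x in lborel. x \<in> G - ({x. d \<le> e \<bullet> x} \<inter> \<Omega>) \<longleftrightarrow> x \<in> G' \<inter> {x. e \<bullet> x < d}"
      using GG' n by eventually_elim (auto simp: G'_def d_def)
  qed
  moreover have "jump_mass K' (jump_pairs \<Omega> (G' \<inter> {x. e \<bullet> x < d})) < jump_mass K' (jump_pairs \<Omega> G')"
  proof (rule halfspace_cut_decreases)
    show "jump_mass K' (jump_pairs \<Omega> G') < \<infinity>" using fin calculation(1) by simp
    show "AE z in lborel. 0 < K' z" using K by eventually_elim (metis pos)
    show "emeasure lborel (G' \<inter> {x. d \<le> e \<bullet> x}) \<noteq> 0"
    proof
      assume "emeasure lborel (G' \<inter> {x. d \<le> e \<bullet> x}) = 0"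
      then have "G' \<inter> {x. d \<le> e \<bullet> x} \<in> null_sets lborel" by auto
      from AE_not_in[OF this] GG' have "AE x in lborel. x \<in> G \<longrightarrow> e \<bullet> x \<le> d"
        by eventually_elim auto
      with dS show False by (simp add: S_def)
    qed
    show "emeasure lborel ({x. e \<bullet> x < d} - G') \<noteq> 0"
    proof
      assume "emeasure lborel ({x. e \<bullet> x < d} - G') = 0"
      then have null: "{x. e \<bullet> x < d} - G' \<in> null_sets lborel" by auto
      define U where "U = {x. e \<bullet> x < min d (- r)}"
      have "open U" unfolding U_def by (intro open_Collect_less continuous_intros)
      moreover have "(- (\<bar>d\<bar> + \<bar>r\<bar> + 1)) *\<^sub>R e \<in> U" by (auto simp: U_def ee)
      ultimately have "\<not> (AE x in lborel. x \<notin> U)" by (rule open_not_AE)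
      moreover have "AE x in lborel. x \<notin> U"
        using AE_not_in[OF null] GG' bdd
      proof eventually_elim
        case (elim x)
        then show ?case using enorm[of x] by (auto simp: U_def)
      qed
      ultimately show False by blast
    qed
  qed (use \<Omega> in \<open>auto simp: G'_def\<close>)
  moreover have "perimeter_in K \<Omega> G \<le> perimeter_in K \<Omega> (G - ({x. d \<le> e \<bullet> x} \<inter> \<Omega>))"
  proof -
    have "{x. d \<le> e \<bullet> x} \<inter> \<Omega> \<in> sets borel" by measurable
    then have "G - ({x. d \<le> e \<bullet> x} \<inter> \<Omega>) \<in> sets lebesgue" using Gm by auto
    moreover have "G - ({x. d \<le> e \<bullet> x} \<inter> \<Omega>) - \<Omega> = G - \<Omega>" by blast
    ultimately show ?thesis using min unfolding perimeter_minimizer_def by blast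
  qed
  ultimately show False by simp
qed

text \<open>
  If \<open>E\<close> exceeded \<open>F\<close> on a set of positive measure, a typical point \<open>y \<in> E - F\<close> would give a level \<open>\<phi> y > 0\<close>
  that \<open>\<phi>\<close> exceeds almost everywhere on \<open>F\<close>, hence on \<open>E - \<Omega>\<close>. Symmetrically a typical \<open>x \<in> F - E\<close>
  gives a level \<open>\<phi> x < 0\<close> with \<open>\<phi> < \<phi> x\<close> almost everywhere on \<open>- F\<close>; here the zero level is
  excluded by assumption. Both levels contradict the intermediate value property outside the ball if \<open>\<phi>\<close> is
  positive somewhere there, and the absence of removable caps otherwise. The latter case occurs even for
  sets \<open>E\<close> with points outside the ball, when these form a null set.
\<close>

lemma ordered_minimizers_coincide:
  fixes K \<phi> :: "real^'n \<Rightarrow> real"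
  assumes ker: "nonlocal_kernel K'" and K: "AE z in lborel. K z = K' z"
    and pos: "\<And>z. 0 < K z"
    and \<Omega>: "open \<Omega>" "bounded \<Omega>"
    and minE: "perimeter_minimizer K \<Omega> E" and finE: "perimeter_in K \<Omega> E < \<infinity>"
    and minF: "perimeter_minimizer K \<Omega> F" and finF: "perimeter_in K \<Omega> F < \<infinity>"
    and eq: "F - \<Omega> = E - \<Omega>"
    and dim: "2 \<le> CARD('n)" and cont: "continuous_on UNIV \<phi>"
    and E: "AE x in lborel. x \<in> E \<longleftrightarrow> 0 < \<phi> x"
    and zero: "AE x in lborel. x \<in> \<Omega> \<longrightarrow> \<phi> x \<noteq> 0"
    and ball: "\<Omega> \<subseteq> ball c R" "- closure E - closure (ball c R) \<noteq> {}"
    and ord1: "AE x in lborel. AE y in lborel. x \<in> F \<longrightarrow> y \<notin> F \<longrightarrow> x \<in> \<Omega> \<or> y \<in> \<Omega> \<longrightarrow> \<phi> y < \<phi> x"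
    and ord2: "AE y in lborel. AE x in lborel. x \<in> F \<longrightarrow> y \<notin> F \<longrightarrow> x \<in> \<Omega> \<or> y \<in> \<Omega> \<longrightarrow> \<phi> y < \<phi> x"
  shows "AE x in lborel. x \<in> F \<longleftrightarrow> x \<in> E"
proof -
  define B where "B = closure (ball c R)"
  have B: "bounded B" "convex B" "closed B" "\<Omega> \<subseteq> B"
    using ball closure_subset[of "ball c R"] unfolding B_def
    by (auto intro!: bounded_closure convex_closure)
  obtain r where r: "\<And>x. x \<in> B \<Longrightarrow> norm x \<le> r" using B(1) by (auto simp: bounded_iff)
  define V where "V = - closure E - B"
  have V: "open V" "V \<noteq> {}"
    using B(3) ball(2) by (auto simp: V_def B_def[symmetric] intro!: open_Diff)
  have V_AE: "\<exists>q\<in>V. P q" if "AE x in lborel. x \<in> V \<longrightarrow> P x" for P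
  proof (rule ccontr)
    assume no: "\<not> (\<exists>q\<in>V. P q)"
    have "AE x in lborel. x \<notin> V" using that by eventually_elim (use no in blast)
    with open_not_AE V show False by blast
  qed
  have VE: "x \<notin> E" "x \<notin> F" "x \<notin> B" if "x \<in> V" for x
    using that closure_subset[of E] B(4) eq unfolding V_def by auto
  have dim': "2 \<le> DIM(real^'n)" using dim by simp
  have out: "x \<in> F \<longleftrightarrow> x \<in> E" if "x \<notin> \<Omega>" for x using eq that by blast
  have "AE x in lborel. x \<in> E \<longrightarrow> x \<in> F"
  proof (rule ccontr)
    assume not: "\<not> ?thesis"
    have "\<exists>y. y \<in> E \<and> y \<notin> F \<and> 0 < \<phi> y \<and>
      (AE x in lborel. x \<in> F \<longrightarrow> y \<notin> F \<longrightarrow> x \<in> \<Omega> \<or> y \<in> \<Omega> \<longrightarrow> \<phi> y < \<phi> x)"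
    proof (rule ccontr)
      assume no: "\<not> ?thesis"
      have "AE y in lborel. y \<in> E \<longrightarrow> y \<in> F"
        using E ord2 by eventually_elim (use no in blast)
      with not show False by blast
    qed
    then obtain y where y: "y \<in> E" "y \<notin> F" "0 < \<phi> y"
      and ordy: "AE x in lborel. x \<in> F \<longrightarrow> y \<notin> F \<longrightarrow> x \<in> \<Omega> \<or> y \<in> \<Omega> \<longrightarrow> \<phi> y < \<phi> x" by blast
    have yF: "AE x in lborel. x \<in> F \<longrightarrow> \<phi> y < \<phi> x"
      using ordy by eventually_elim (use out[of y] y in blast)
    show False
    proof (cases "\<exists>p. p \<notin> B \<and> 0 < \<phi> p")
      case True
      then obtain p where p: "p \<notin> B" "0 < \<phi> p" by blast
      have "\<exists>q\<in>V. \<phi> q \<le> 0"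
        by (rule V_AE) (use E in eventually_elim, use VE in force)
      then obtain q where q: "q \<notin> B" "\<phi> q < \<phi> y" using VE y by force
      have "AE x in lborel. x \<notin> B \<longrightarrow> \<phi> x \<le> 0 \<or> \<phi> y \<le> \<phi> x"
        using E yF
      proof eventually_elim
        case (elim x)
        then show ?case using out[of x] B(4) by force
      qed
      with exterior_intermediate_value[OF cont dim' B(1-3) p(1) q(1) p(2) q(2) y(3)]
      show False by blast
    next
      case False
      show False
      proof (rule minimizer_cap_contradiction[OF ker K pos \<Omega> minE finE cont])
        show "AE x in lborel. x \<in> E \<longrightarrow> norm x \<le> r"
          using E by eventually_elim (use r False in blast)
        show "\<not> (AE x in lborel. x \<notin> E)"
        proof
          assume "AE x in lborel. x \<notin> E"
          then have "AE x in lborel. x \<in> E \<longrightarrow> x \<in> F" by eventually_elim blast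
          with not show False by blast
        qed
        show "AE x in lborel. 0 < \<phi> x \<longrightarrow> x \<in> E" using E by eventually_elim blast
        show "AE x in lborel. x \<in> E - \<Omega> \<longrightarrow> \<phi> y \<le> \<phi> x"
          using yF by eventually_elim (use out in force)
      qed fact
    qed
  qed
  moreover have "AE x in lborel. x \<in> F \<longrightarrow> x \<in> E"
  proof (rule ccontr)
    assume not: "\<not> ?thesis"
    have "\<exists>x. x \<in> F \<and> x \<notin> E \<and> \<phi> x < 0 \<and>
      (AE y in lborel. x \<in> F \<longrightarrow> y \<notin> F \<longrightarrow> x \<in> \<Omega> \<or> y \<in> \<Omega> \<longrightarrow> \<phi> y < \<phi> x)"
    proof (rule ccontr)
      assume no: "\<not> ?thesis"
      have "AE x in lborel. x \<in> F \<longrightarrow> x \<in> E"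
        using E ord1 zero
      proof eventually_elim
        case (elim x)
        show ?case
        proof (rule impI, rule ccontr)
          assume x: "x \<in> F" "x \<notin> E"
          then have "\<phi> x < 0" using elim out[of x] by force
          with no elim x show False by blast
        qed
      qed
      with not show False by blast
    qed
    then obtain x where x: "x \<in> F" "x \<notin> E" "\<phi> x < 0"
      and ordx: "AE y in lborel. x \<in> F \<longrightarrow> y \<notin> F \<longrightarrow> x \<in> \<Omega> \<or> y \<in> \<Omega> \<longrightarrow> \<phi> y < \<phi> x" by blast
    have xF: "AE y in lborel. y \<notin> F \<longrightarrow> \<phi> y < \<phi> x"
      using ordx by eventually_elim (use out[of x] x in blast)
    show False
    proof (cases "\<exists>p. p \<notin> B \<and> 0 < \<phi> p")
      case True
      then obtain p where p: "p \<notin> B" "\<phi> x < \<phi> p" using x by force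
      have "\<exists>q\<in>V. \<phi> q < \<phi> x"
        by (rule V_AE) (use xF in eventually_elim, use VE in blast)
      then obtain q where q: "q \<notin> B" "\<phi> q < 0" using VE x by force
      have "AE y in lborel. y \<notin> B \<longrightarrow> \<phi> y \<le> \<phi> x \<or> 0 \<le> \<phi> y"
        using E xF
      proof eventually_elim
        case (elim y)
        then show ?case using out[of y] B(4) by force
      qed
      with exterior_intermediate_value[OF cont dim' B(1-3) p(1) q(1) p(2) q(2) x(3)]
      show False by blast
    next
      case False
      show False
      proof (rule minimizer_cap_contradiction[OF ker K pos \<Omega> minF finF cont])
        show "AE y in lborel. y \<in> F \<longrightarrow> norm y \<le> r"
          using E by eventually_elim (use r False out B(4) in blast)
        show "\<not> (AE x in lborel. x \<notin> F)"
        proof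
          assume "AE x in lborel. x \<notin> F"
          then have "AE x in lborel. x \<in> F \<longrightarrow> x \<in> E" by eventually_elim blast
          with not show False by blast
        qed
        show "AE y in lborel. \<phi> x < \<phi> y \<longrightarrow> y \<in> F" using xF by eventually_elim force
        show "AE y in lborel. y \<in> F - \<Omega> \<longrightarrow> 0 \<le> \<phi> y"
          using E by eventually_elim (use out in force)
      qed fact
    qed
  qed
  ultimately show ?thesis by eventually_elim blast
qed

section \<open>Sub- and supersolutions calibrate the perimeter\<close>

theorem theorem2p4:
  fixes K :: "real^'n \<Rightarrow> real" and \<Omega> E :: "(real^'n) set" and \<phi> :: "real^'n \<Rightarrow> real"
  assumes K_meas: "K \<in> borel_measurable lebesgue"
    and K_nonneg: "\<And>z. K z \<ge> 0"
    and K_even: "\<And>z. K (- z) = K z"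
    and K_int: "integrable lebesgue (\<lambda>z. min 1 (norm z) * K z)"
    and \<Omega>_bounded: "bounded \<Omega>"
    and \<Omega>_open: "open \<Omega>"
    and \<Omega>_perimeter: "perimeter K \<Omega> < \<infinity>"
    and E_meas: "E \<in> sets lebesgue"
    and foliation: "adapted_foliation K \<Omega> E \<phi>"
  shows
    "perimeter_minimizer K \<Omega> E
   \<and> (CARD('n) \<ge> 2 \<and>
      (\<forall>z. K z > 0) \<and>
      continuous_on UNIV \<phi> \<and>
      {x. \<phi> x = 0} \<inter> \<Omega> \<in> null_sets lebesgue \<and>
      (\<exists>c R. R > 0 \<and> \<Omega> \<subseteq> ball c R \<and>
         E - closure (ball c R) \<noteq> {} \<and> - closure E - closure (ball c R) \<noteq> {})
      \<longrightarrow> (\<forall>F. perimeter_minimizer K \<Omega> F \<and> F - \<Omega> = E - \<Omega> \<longrightarrow>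
             (AE x in lebesgue. x \<in> F \<longleftrightarrow> x \<in> E)))
   \<and> ((AE x in lebesgue. x \<in> \<Omega> \<longrightarrow> nonlocal_curvature K \<phi> x = 0)
      \<longrightarrow> (\<forall>F\<in>sets lebesgue. F - \<Omega> = E - \<Omega> \<and> perimeter_in K \<Omega> F < \<infinity> \<longrightarrow>
             calibration K \<Omega> \<phi> F = calibration K \<Omega> \<phi> E))"
proof -
  obtain K' where ker: "nonlocal_kernel K'" and KK': "AE z in lborel. K z = K' z"
    using kernel_borel_representative[OF K_meas K_nonneg K_even K_int] by blast
  interpret nonlocal_kernel K' by (fact ker)
  note fol = foliation[unfolded adapted_foliation_def]
  obtain \<phi>' where \<phi>'m [measurable]: "\<phi>' \<in> borel_measurable borel" and \<phi>\<phi>': "AE x in lborel. \<phi> x = \<phi>' x"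
    using completion_ex_borel_measurable_real[of \<phi> lborel] fol by auto
  define E' where "E' = {x. 0 < \<phi>' x}"
  have E'm [measurable]: "E' \<in> sets borel" unfolding E'_def by measurable
  have E\<phi>: "AE x in lborel. x \<in> E \<longleftrightarrow> 0 < \<phi> x"
    using fol by (simp add: AE_completion_iff)
  have EE': "AE x in lborel. x \<in> E \<longleftrightarrow> x \<in> E'"
    using E\<phi> \<phi>\<phi>' by eventually_elim (simp add: E'_def)
  have \<Omega>m [measurable]: "\<Omega> \<in> sets borel" using \<Omega>_open by simp
  define H where "H = nonlocal_curvature K \<phi>"
  have conv: "converges_in_L1_on \<Omega> (truncated_curvature K \<phi>) H (at_right 0)"
    using fol by (simp add: H_def)
  have H_in: "AE x in lebesgue. x \<in> \<Omega> \<inter> E \<longrightarrow> H x \<le> 0" and H_out: "AE x in lebesgue. x \<in> \<Omega> - E \<longrightarrow> 0 \<le> H x"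
    using fol by (simp_all add: H_def)
  \<comment> \<open>The limit of the curvature correction in the comparison of \<open>F\<close> with \<open>E\<close>.\<close>
  define gap where "gap F = (\<integral>x. (indicator F x - indicator E x) * H x \<partial>lebesgue)" for F
  have gap_nonneg: "0 \<le> gap F" if "F - \<Omega> = E - \<Omega>" for F
    unfolding gap_def
  proof (rule integral_nonneg_AE)
    show "AE x in lebesgue. 0 \<le> (indicator F x - indicator E x) * H x"
      using H_in H_out
    proof eventually_elim
      case (elim x)
      have "x \<notin> \<Omega> \<Longrightarrow> x \<in> F \<longleftrightarrow> x \<in> E" using that by blast
      then show ?case using elim by (auto simp: indicator_def)
    qed
  qed
  have rep: "\<exists>F'. F' \<in> sets borel \<and> (AE x in lborel. x \<in> F \<longleftrightarrow> x \<in> F') \<and> F' - \<Omega> = E' - \<Omega>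
      \<and> perimeter_in K \<Omega> F = jump_mass K' (jump_pairs \<Omega> F')
      \<and> (\<lambda>n. curvature_pairing (truncate_kernel K' (1 / real (Suc n))) \<phi>' F' E') \<longlonglongrightarrow> gap F"
    if F: "F \<in> sets lebesgue" "F - \<Omega> = E - \<Omega>" for F
  proof -
    obtain F' where F': "F' \<in> sets borel" "AE x in lborel. x \<in> F \<longleftrightarrow> x \<in> F'" "F' - \<Omega> = E' - \<Omega>"
      using competitor_borel_representative[OF F(1) \<Omega>m E'm F(2) EE'] by blast
    show ?thesis
      using F' perimeter_in_representative[OF ker KK' F'(1,2) \<Omega>m]
        curvature_pairing_tendsto[OF ker KK' \<phi>'m \<phi>\<phi>' F'(1,2) E'm EE' F(2) F(1) E_meas conv]
      unfolding gap_def by blast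
  qed
  have perE: "perimeter_in K \<Omega> E = jump_mass K' (jump_pairs \<Omega> E')"
    by (rule perimeter_in_representative[OF ker KK' E'm EE' \<Omega>m])
  have E_le: "perimeter_in K \<Omega> E \<le> perimeter_in K \<Omega> F" if F: "F \<in> sets lebesgue" "F - \<Omega> = E - \<Omega>" for F
  proof -
    obtain F' where F': "F' \<in> sets borel" "F' - \<Omega> = E' - \<Omega>"
        "perimeter_in K \<Omega> F = jump_mass K' (jump_pairs \<Omega> F')"
        "(\<lambda>n. curvature_pairing (truncate_kernel K' (1 / real (Suc n))) \<phi>' F' E') \<longlonglongrightarrow> gap F"
      using rep[OF F] by blast
    show ?thesis unfolding perE F'(3)
      by (rule calibrated_mass_le[OF F'(1) \<Omega>m \<phi>'m \<Omega>_bounded E'_def F'(2,4) gap_nonneg[OF F(2)]])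
  qed
  have min: "perimeter_minimizer K \<Omega> E"
    unfolding perimeter_minimizer_def using E_meas E_le by blast
  \<comment> \<open>The competitor \<open>E - \<Omega>\<close> shows that \<open>E\<close> has finite perimeter.\<close>
  have fin: "perimeter_in K \<Omega> E < \<infinity>"
  proof -
    have \<Omega>l: "\<Omega> \<in> sets lebesgue" using \<Omega>m by auto
    have split: "(E - \<Omega>) \<inter> \<Omega> = {}" "- (E - \<Omega>) \<inter> \<Omega> = \<Omega>" "(E - \<Omega>) \<inter> - \<Omega> = E - \<Omega>"
      by blast+
    have "interaction K \<Omega> (E - \<Omega>) \<le> interaction K \<Omega> (- \<Omega>)"
      unfolding interaction_def
      by (intro nn_integral_mono mult_mono) (auto simp: indicator_def)
    then have "perimeter_in K \<Omega> (E - \<Omega>) \<le> perimeter K \<Omega>"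
      unfolding perimeter_in_def perimeter_def split by (simp add: interaction_def)
    then show ?thesis
      using E_le[of "E - \<Omega>"] E_meas \<Omega>l \<Omega>_perimeter by (auto intro: le_less_trans)
  qed
  have uniq: "AE x in lebesgue. x \<in> F \<longleftrightarrow> x \<in> E"
    if dim: "CARD('n) \<ge> 2" and pos: "\<And>z. K z > 0" and cont: "continuous_on UNIV \<phi>"
      and zero: "{x. \<phi> x = 0} \<inter> \<Omega> \<in> null_sets lebesgue"
      and ball: "\<Omega> \<subseteq> ball c R" "- closure E - closure (ball c R) \<noteq> {}"
      and minF: "perimeter_minimizer K \<Omega> F" and eq: "F - \<Omega> = E - \<Omega>" for F c R
  proof -
    have Fm: "F \<in> sets lebesgue" using minF by (simp add: perimeter_minimizer_def)
    obtain F' where F': "F' \<in> sets borel" "AE x in lborel. x \<in> F \<longleftrightarrow> x \<in> F'" "F' - \<Omega> = E' - \<Omega>"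
        "perimeter_in K \<Omega> F = jump_mass K' (jump_pairs \<Omega> F')"
        "(\<lambda>n. curvature_pairing (truncate_kernel K' (1 / real (Suc n))) \<phi>' F' E') \<longlonglongrightarrow> gap F"
      using rep[OF Fm eq] by blast
    have same: "perimeter_in K \<Omega> F = perimeter_in K \<Omega> E"
      using E_le[OF Fm eq] minF E_meas eq by (auto simp: perimeter_minimizer_def intro: antisym)
    have pos': "AE z in lborel. 0 < K' z" using KK' by eventually_elim (metis pos)
    have ord: "AE z in lborel \<Otimes>\<^sub>M lborel. z \<in> jump_pairs \<Omega> F' \<longrightarrow> \<phi>' (snd z) < \<phi>' (fst z)"
      by (rule equal_mass_imp_ordered[OF F'(1) \<Omega>m \<phi>'m \<Omega>_bounded E'_def F'(3,5) gap_nonneg[OF eq] _ _ pos'])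
         (use fin same perE F'(4) in auto)
    have pair: "AE z in lborel \<Otimes>\<^sub>M lborel. fst z \<in> F \<longrightarrow> snd z \<notin> F \<longrightarrow> fst z \<in> \<Omega> \<or> snd z \<in> \<Omega>
        \<longrightarrow> \<phi> (snd z) < \<phi> (fst z)"
      using ord AE_lborel_pair_fst[OF F'(2)] AE_lborel_pair_snd[OF F'(2)]
        AE_lborel_pair_fst[OF \<phi>\<phi>'] AE_lborel_pair_snd[OF \<phi>\<phi>']
    proof eventually_elim
      case (elim z)
      then show ?case by (cases z) (simp add: jump_pairs_def)
    qed
    have ord1: "AE x in lborel. AE y in lborel. x \<in> F \<longrightarrow> y \<notin> F \<longrightarrow> x \<in> \<Omega> \<or> y \<in> \<Omega> \<longrightarrow> \<phi> y < \<phi> x"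
      using lborel_pair.AE_pair[OF pair] by simp
    have ord2: "AE y in lborel. AE x in lborel. x \<in> F \<longrightarrow> y \<notin> F \<longrightarrow> x \<in> \<Omega> \<or> y \<in> \<Omega> \<longrightarrow> \<phi> y < \<phi> x"
      using lborel_pair.AE_pair[OF AE_lborel_pair_swap[OF pair]] by simp
    have zero': "AE x in lborel. x \<in> \<Omega> \<longrightarrow> \<phi> x \<noteq> 0"
      using AE_not_in[OF zero] unfolding AE_completion_iff by eventually_elim auto
    have finF: "perimeter_in K \<Omega> F < \<infinity>" using same fin by simp
    show ?thesis unfolding AE_completion_iff
      by (rule ordered_minimizers_coincide[OF ker KK' pos \<Omega>_open \<Omega>_bounded min fin minF finF
            eq dim cont E\<phi> zero' ball ord1 ord2])
  qed
  have null_lagrangian: "calibration K \<Omega> \<phi> F = calibration K \<Omega> \<phi> E"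
    if H0: "AE x in lebesgue. x \<in> \<Omega> \<longrightarrow> nonlocal_curvature K \<phi> x = 0"
      and Fm: "F \<in> sets lebesgue" and eq: "F - \<Omega> = E - \<Omega>" and finF: "perimeter_in K \<Omega> F < \<infinity>" for F
  proof -
    obtain F' where F': "F' \<in> sets borel" "AE x in lborel. x \<in> F \<longleftrightarrow> x \<in> F'" "F' - \<Omega> = E' - \<Omega>"
        "perimeter_in K \<Omega> F = jump_mass K' (jump_pairs \<Omega> F')"
        "(\<lambda>n. curvature_pairing (truncate_kernel K' (1 / real (Suc n))) \<phi>' F' E') \<longlonglongrightarrow> gap F"
      using rep[OF Fm eq] by blast
    have "gap F = 0"
      unfolding gap_def
    proof (rule integral_eq_zero_AE)
      show "AE x in lebesgue. (indicator F x - indicator E x) * H x = 0"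
        using H0
      proof eventually_elim
        case (elim x)
        have "x \<notin> \<Omega> \<Longrightarrow> x \<in> F \<longleftrightarrow> x \<in> E" using eq by blast
        then show ?case using elim by (auto simp: indicator_def H_def)
      qed
    qed
    moreover have finF': "jump_mass K' (jump_pairs \<Omega> F') < \<infinity>" and finE': "jump_mass K' (jump_pairs \<Omega> E') < \<infinity>"
      using finF fin perE F'(4) by auto
    ultimately have "jump_flux K' (level_sign \<phi>') (jump_pairs \<Omega> F') = jump_flux K' (level_sign \<phi>') (jump_pairs \<Omega> E')"
      using flux_diff_eq_limit[OF F'(1) E'm \<Omega>m \<phi>'m \<Omega>_bounded F'(3,5)] by simp
    then show ?thesis
      using calibration_representative[OF ker KK' F'(1,2) \<phi>'m \<phi>\<phi>' \<Omega>m finF']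
        calibration_representative[OF ker KK' E'm EE' \<phi>'m \<phi>\<phi>' \<Omega>m finE'] by simp
  qed
  show ?thesis
    using min uniq null_lagrangian by blast
qed

end
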